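(* For $n=1,2,\ldots$, the topological structure \[ \underset{\sim}{\mathbf{Z}}_{2n} = (\mathbf{Z}_{2n}; f_2,\ldots,f_n, g, \approx_1,\ldots,\approx_{n-1},\mathcal{T}) \] is an alter ego for the algebra $\mathbf{Z}_{2n}$ which yields a strong duality on $\mathsf{SA}_{2n}=\mathbb{ISP}(\mathbf{Z}_{2n})$.
   Context: Let $\mathbf{Z}=(\mathbb{Z};\wedge,\vee,\to,\neg)$ be the integers with the lattice operations of the natural order, $\neg a=-a$, and $a\to b=(-a)\vee b$ if $a\le b$, $a\to b=(-a)\wedge b$ otherwise. For $n\ge1$, $\mathbf{Z}_{2n}$ is the subalgebra with universe $\{a\in\mathbb{Z}\mid -n\le a\le n,\ a\ne 0\}$, and $\mathsf{SA}_{2n}=\mathbb{ISP}(\mathbf{Z}_{2n})$. The operations in the alter ego are: for $1<i\le n$, the partial endomorphism $f_i$ with domain $\mathbf{Z}_{2n}\setminus\{i,-i\}$, $f_i(i-1)=i$, $f_i(-(i-1))=-i$, $f_i(a)=a$ otherwise; the partial endomorphism $g$ with domain $\mathbf{Z}_{2n}\setminus\{1,-1\}$, $g(a)=a-1$ if $a>0$ and $g(a)=a+1$ otherwise; for $1\le m\le n-1$, the binary relation (congruence) $\approx_m$ on $\mathbf{Z}_{2n}$ given by $a\approx_m b$ iff $a=b$ or $-m\le a,b\le m$; $\mathcal{T}$ is the discrete topology. "Alter ego" and "strong duality" are in the sense of natural duality theory. *)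

theory Defs
  imports "HOL-Analysis.Function_Topology"
begin

section \<open>Algebras and the class ISP\<close>

text \<open>A signature maps each of its symbols to an arity; symbols mapped to \<^term>\<open>None\<close> do not
  belong to it, and what a record below assigns to them is ignored.\<close>

type_synonym 's signature = "'s \<rightharpoonup> nat"

definition tuples :: "'a set \<Rightarrow> nat \<Rightarrow> 'a list set" where
  "tuples U k = {xs. set xs \<subseteq> U \<and> length xs = k}"

record ('f, 'a) algebra =
  universe :: "'a set"
  oper :: "'f \<Rightarrow> 'a list \<Rightarrow> 'a"

definition subuniverse :: "'f signature \<Rightarrow> ('f, 'a) algebra \<Rightarrow> 'a set \<Rightarrow> bool" where
  "subuniverse \<sigma> A S \<longleftrightarrow> S \<subseteq> universe A \<and>
     (\<forall>f k. \<sigma> f = Some k \<longrightarrow> (\<forall>xs\<in>tuples S k. oper A f xs \<in> S))"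

definition is_algebra :: "'f signature \<Rightarrow> ('f, 'a) algebra \<Rightarrow> bool" where
  "is_algebra \<sigma> A \<longleftrightarrow> universe A \<noteq> {} \<and> subuniverse \<sigma> A (universe A)"

definition subalgebra_on :: "('f, 'a) algebra \<Rightarrow> 'a set \<Rightarrow> ('f, 'a) algebra" where
  "subalgebra_on A S = \<lparr>universe = S, oper = oper A\<rparr>"

definition power_algebra :: "('f, 'a) algebra \<Rightarrow> 'i set \<Rightarrow> ('f, 'i \<Rightarrow> 'a) algebra" where
  "power_algebra M I =
     \<lparr>universe = I \<rightarrow>\<^sub>E universe M,
      oper = (\<lambda>f xs. \<lambda>i\<in>I. oper M f (map (\<lambda>x. x i) xs))\<rparr>"

text \<open>Maps between universes are kept extensional (\<^term>\<open>undefined\<close> outside the domain), so that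
  hom-sets are subsets of powers.\<close>

definition alg_hom :: "'f signature \<Rightarrow> ('f, 'a) algebra \<Rightarrow> ('f, 'b) algebra \<Rightarrow> ('a \<Rightarrow> 'b) set" where
  "alg_hom \<sigma> A B = {\<phi> \<in> universe A \<rightarrow>\<^sub>E universe B.
     \<forall>f k. \<sigma> f = Some k \<longrightarrow>
       (\<forall>xs\<in>tuples (universe A) k. \<phi> (oper A f xs) = oper B f (map \<phi> xs))}"

definition alg_iso :: "'f signature \<Rightarrow> ('f, 'a) algebra \<Rightarrow> ('f, 'b) algebra \<Rightarrow> ('a \<Rightarrow> 'b) set" where
  "alg_iso \<sigma> A B = {\<phi> \<in> alg_hom \<sigma> A B. bij_betw \<phi> (universe A) (universe B)}"

text \<open>The type argument bounds the index sets of the powers; a statement in which it is a free type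
  variable speaks about all index sets. The empty index set is allowed.\<close>

definition ISP :: "'i itself \<Rightarrow> 'f signature \<Rightarrow> ('f, 'm) algebra \<Rightarrow> ('f, 'a) algebra set" where
  "ISP _ \<sigma> M = {A. is_algebra \<sigma> A \<and>
     (\<exists>(I :: 'i set) S. S \<noteq> {} \<and> subuniverse \<sigma> (power_algebra M I) S \<and>
        alg_iso \<sigma> A (subalgebra_on (power_algebra M I) S) \<noteq> {})}"


section \<open>Topological structures with partial operations and relations\<close>

text \<open>Total operations need no separate treatment: they are the partial operations that are defined
  everywhere. The underlying set is the \<^const>\<open>topspace\<close> of the topology and may be empty.\<close>

record ('h, 'r, 'x) tstructure =
  topo :: "'x topology"
  poper :: "'h \<Rightarrow> 'x list \<Rightarrow> 'x option"
  rels :: "'r \<Rightarrow> 'x list set"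

abbreviation points :: "('h, 'r, 'x) tstructure \<Rightarrow> 'x set" where
  "points X \<equiv> topspace (topo X)"

definition is_tstructure ::
  "'h signature \<Rightarrow> 'r signature \<Rightarrow> ('h, 'r, 'x) tstructure \<Rightarrow> bool" where
  "is_tstructure \<pi> \<rho> X \<longleftrightarrow>
     (\<forall>h k. \<pi> h = Some k \<longrightarrow>
        dom (poper X h) \<subseteq> tuples (points X) k \<and> ran (poper X h) \<subseteq> points X) \<and>
     (\<forall>r k. \<rho> r = Some k \<longrightarrow> rels X r \<subseteq> tuples (points X) k)"

definition substructure_on ::
  "('h, 'r, 'x) tstructure \<Rightarrow> 'x set \<Rightarrow> ('h, 'r, 'x) tstructure" where
  "substructure_on X S =
     \<lparr>topo = subtopology (topo X) S,
      poper = (\<lambda>h xs. if set xs \<subseteq> S then poper X h xs else None),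
      rels = (\<lambda>r. {xs \<in> rels X r. set xs \<subseteq> S})\<rparr>"

definition closed_substructure ::
  "'h signature \<Rightarrow> ('h, 'r, 'x) tstructure \<Rightarrow> 'x set \<Rightarrow> bool" where
  "closed_substructure \<pi> X S \<longleftrightarrow> closedin (topo X) S \<and>
     (\<forall>h k. \<pi> h = Some k \<longrightarrow>
        (\<forall>xs\<in>tuples S k. \<forall>y. poper X h xs = Some y \<longrightarrow> y \<in> S))"

text \<open>A partial operation is defined at a tuple of a power iff it is defined in every coordinate.\<close>

definition power_structure ::
  "('h, 'r, 'x) tstructure \<Rightarrow> 'i set \<Rightarrow> ('h, 'r, 'i \<Rightarrow> 'x) tstructure" where
  "power_structure M I =
     \<lparr>topo = product_topology (\<lambda>_. topo M) I,
      poper = (\<lambda>h xs.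
        if set xs \<subseteq> (I \<rightarrow>\<^sub>E points M) \<and> (\<forall>i\<in>I. poper M h (map (\<lambda>x. x i) xs) \<noteq> None)
        then Some (\<lambda>i\<in>I. the (poper M h (map (\<lambda>x. x i) xs)))
        else None),
      rels = (\<lambda>r. {xs. set xs \<subseteq> (I \<rightarrow>\<^sub>E points M) \<and> (\<forall>i\<in>I. map (\<lambda>x. x i) xs \<in> rels M r)})\<rparr>"

definition str_hom ::
  "'h signature \<Rightarrow> 'r signature \<Rightarrow> ('h, 'r, 'x) tstructure \<Rightarrow> ('h, 'r, 'y) tstructure \<Rightarrow> ('x \<Rightarrow> 'y) set"
  where
  "str_hom \<pi> \<rho> X Y = {\<phi> \<in> points X \<rightarrow>\<^sub>E points Y.
     continuous_map (topo X) (topo Y) \<phi> \<and>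
     (\<forall>h k. \<pi> h = Some k \<longrightarrow> (\<forall>xs\<in>tuples (points X) k. \<forall>y.
        poper X h xs = Some y \<longrightarrow> poper Y h (map \<phi> xs) = Some (\<phi> y))) \<and>
     (\<forall>r k. \<rho> r = Some k \<longrightarrow> (\<forall>xs\<in>tuples (points X) k.
        xs \<in> rels X r \<longrightarrow> map \<phi> xs \<in> rels Y r))}"

definition str_iso ::
  "'h signature \<Rightarrow> 'r signature \<Rightarrow> ('h, 'r, 'x) tstructure \<Rightarrow> ('h, 'r, 'y) tstructure \<Rightarrow> ('x \<Rightarrow> 'y) set"
  where
  "str_iso \<pi> \<rho> X Y = {\<phi> \<in> str_hom \<pi> \<rho> X Y. \<exists>\<psi>\<in>str_hom \<pi> \<rho> Y X.
     (\<forall>x\<in>points X. \<psi> (\<phi> x) = x) \<and> (\<forall>y\<in>points Y. \<phi> (\<psi> y) = y)}"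

text \<open>An embedding is an isomorphism onto a closed substructure.\<close>

definition str_embedding ::
  "'h signature \<Rightarrow> 'r signature \<Rightarrow> ('h, 'r, 'x) tstructure \<Rightarrow> ('h, 'r, 'y) tstructure \<Rightarrow> ('x \<Rightarrow> 'y) set"
  where
  "str_embedding \<pi> \<rho> X Y = {\<phi>. closed_substructure \<pi> Y (\<phi> ` points X) \<and>
     \<phi> \<in> str_iso \<pi> \<rho> X (substructure_on Y (\<phi> ` points X))}"

text \<open>Isomorphic copies of closed substructures of powers with nonempty index set; the empty
  substructure is included whenever it is closed under the operations.\<close>

definition IScP ::
  "'i itself \<Rightarrow> 'h signature \<Rightarrow> 'r signature \<Rightarrow> ('h, 'r, 'm) tstructure \<Rightarrow> ('h, 'r, 'x) tstructure set"
  where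
  "IScP _ \<pi> \<rho> M = {X. is_tstructure \<pi> \<rho> X \<and>
     (\<exists>(I :: 'i set) S. I \<noteq> {} \<and> closed_substructure \<pi> (power_structure M I) S \<and>
        str_iso \<pi> \<rho> X (substructure_on (power_structure M I) S) \<noteq> {})}"


section \<open>Alter egos and dualities\<close>

text \<open>The domain of a partial operation is a subuniverse of a power of \<open>M\<close> and may be empty.
  A \<open>k\<close>-tuple is a list here, whereas the elements of the power are functions on \<^term>\<open>{..<k}\<close>.\<close>

definition as_power :: "'a list \<Rightarrow> nat \<Rightarrow> 'a" where
  "as_power xs = (\<lambda>i\<in>{..<length xs}. xs ! i)"

definition alter_ego ::
  "'f signature \<Rightarrow> 'h signature \<Rightarrow> 'r signature \<Rightarrow>
   ('f, 'm) algebra \<Rightarrow> ('h, 'r, 'm) tstructure \<Rightarrow> bool" where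
  "alter_ego \<sigma> \<pi> \<rho> M N \<longleftrightarrow>
     is_algebra \<sigma> M \<and> finite (universe M) \<and> is_tstructure \<pi> \<rho> N \<and>
     topo N = discrete_topology (universe M) \<and>
     (\<forall>h k. \<pi> h = Some k \<longrightarrow>
        (let D = as_power ` dom (poper N h)
         in subuniverse \<sigma> (power_algebra M {..<k}) D \<and>
            (\<lambda>x\<in>D. the (poper N h (map x [0..<k])))
              \<in> alg_hom \<sigma> (subalgebra_on (power_algebra M {..<k}) D) M)) \<and>
     (\<forall>r k. \<rho> r = Some k \<longrightarrow>
        subuniverse \<sigma> (power_algebra M {..<k}) (as_power ` rels N r))"

text \<open>The dual of an algebra \<open>A\<close> is \<open>hom(A, M)\<close> as a substructure of the power of \<open>N\<close> indexed
  by \<open>A\<close>; the dual of a structure \<open>X\<close> is \<open>hom(X, N)\<close> as a subalgebra of the power of \<open>M\<close> indexed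
  by \<open>X\<close>.\<close>

definition dual_of_algebra ::
  "'f signature \<Rightarrow> ('f, 'm) algebra \<Rightarrow> ('h, 'r, 'm) tstructure \<Rightarrow>
   ('f, 'a) algebra \<Rightarrow> ('h, 'r, 'a \<Rightarrow> 'm) tstructure" where
  "dual_of_algebra \<sigma> M N A = substructure_on (power_structure N (universe A)) (alg_hom \<sigma> A M)"

definition dual_of_structure ::
  "'h signature \<Rightarrow> 'r signature \<Rightarrow> ('f, 'm) algebra \<Rightarrow> ('h, 'r, 'm) tstructure \<Rightarrow>
   ('h, 'r, 'x) tstructure \<Rightarrow> ('f, 'x \<Rightarrow> 'm) algebra" where
  "dual_of_structure \<pi> \<rho> M N X = subalgebra_on (power_algebra M (points X)) (str_hom \<pi> \<rho> X N)"

definition evaluation :: "'a set \<Rightarrow> ('a \<Rightarrow> 'm) set \<Rightarrow> 'a \<Rightarrow> ('a \<Rightarrow> 'm) \<Rightarrow> 'm" where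
  "evaluation U H = (\<lambda>a\<in>U. \<lambda>u\<in>H. u a)"

definition yields_duality ::
  "'i itself \<Rightarrow> 'a itself \<Rightarrow> 'f signature \<Rightarrow> 'h signature \<Rightarrow> 'r signature \<Rightarrow>
   ('f, 'm) algebra \<Rightarrow> ('h, 'r, 'm) tstructure \<Rightarrow> bool" where
  "yields_duality \<iota> _ \<sigma> \<pi> \<rho> M N \<longleftrightarrow>
     (\<forall>A :: ('f, 'a) algebra. A \<in> ISP \<iota> \<sigma> M \<longrightarrow>
        evaluation (universe A) (alg_hom \<sigma> A M)
          \<in> alg_iso \<sigma> A (dual_of_structure \<pi> \<rho> M N (dual_of_algebra \<sigma> M N A)))"

definition yields_full_duality ::
  "'i itself \<Rightarrow> 'a itself \<Rightarrow> 'x itself \<Rightarrow> 'f signature \<Rightarrow> 'h signature \<Rightarrow> 'r signature \<Rightarrow>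
   ('f, 'm) algebra \<Rightarrow> ('h, 'r, 'm) tstructure \<Rightarrow> bool" where
  "yields_full_duality \<iota> \<alpha> _ \<sigma> \<pi> \<rho> M N \<longleftrightarrow>
     yields_duality \<iota> \<alpha> \<sigma> \<pi> \<rho> M N \<and>
     (\<forall>X :: ('h, 'r, 'x) tstructure. X \<in> IScP \<iota> \<pi> \<rho> N \<longrightarrow>
        evaluation (points X) (str_hom \<pi> \<rho> X N)
          \<in> str_iso \<pi> \<rho> X (dual_of_algebra \<sigma> M N (dual_of_structure \<pi> \<rho> M N X)))"

definition injective_in_IScP ::
  "'i itself \<Rightarrow> 'x itself \<Rightarrow> 'y itself \<Rightarrow> 'h signature \<Rightarrow> 'r signature \<Rightarrow>
   ('h, 'r, 'm) tstructure \<Rightarrow> bool" where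
  "injective_in_IScP \<iota> _ _ \<pi> \<rho> N \<longleftrightarrow>
     (\<forall>(X :: ('h, 'r, 'x) tstructure) (Y :: ('h, 'r, 'y) tstructure).
        X \<in> IScP \<iota> \<pi> \<rho> N \<longrightarrow> Y \<in> IScP \<iota> \<pi> \<rho> N \<longrightarrow>
        (\<forall>\<phi>\<in>str_embedding \<pi> \<rho> X Y. \<forall>u\<in>str_hom \<pi> \<rho> X N.
           \<exists>v\<in>str_hom \<pi> \<rho> Y N. \<forall>x\<in>points X. v (\<phi> x) = u x))"

text \<open>The four type arguments are the types of the indices of powers, of the elements of algebras,
  and of the elements of the two structures occurring in the injectivity condition.\<close>

definition yields_strong_duality ::
  "'i itself \<Rightarrow> 'a itself \<Rightarrow> 'x itself \<Rightarrow> 'y itself \<Rightarrow>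
   'f signature \<Rightarrow> 'h signature \<Rightarrow> 'r signature \<Rightarrow>
   ('f, 'm) algebra \<Rightarrow> ('h, 'r, 'm) tstructure \<Rightarrow> bool" where
  "yields_strong_duality \<iota> \<alpha> \<xi> \<upsilon> \<sigma> \<pi> \<rho> M N \<longleftrightarrow>
     yields_full_duality \<iota> \<alpha> \<xi> \<sigma> \<pi> \<rho> M N \<and> injective_in_IScP \<iota> \<xi> \<upsilon> \<pi> \<rho> N"


section \<open>The algebras \<open>Z\<^sub>2\<^sub>n\<close> and their alter egos\<close>

datatype sugihara_symbol = Meet | Join | Imp | Neg

fun sugihara_signature :: "sugihara_symbol signature" where
  "sugihara_signature Neg = Some 1"
| "sugihara_signature _ = Some 2"

fun Z_oper :: "sugihara_symbol \<Rightarrow> int list \<Rightarrow> int" where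
  "Z_oper Meet [a, b] = min a b"
| "Z_oper Join [a, b] = max a b"
| "Z_oper Imp [a, b] = (if a \<le> b then max (- a) b else min (- a) b)"
| "Z_oper Neg [a] = - a"
| "Z_oper _ _ = undefined"

definition Z_algebra :: "(sugihara_symbol, int) algebra" where
  "Z_algebra = \<lparr>universe = UNIV, oper = Z_oper\<rparr>"

definition Z_even_universe :: "nat \<Rightarrow> int set" where
  "Z_even_universe n = {a. - int n \<le> a \<and> a \<le> int n \<and> a \<noteq> 0}"

definition Z_even :: "nat \<Rightarrow> (sugihara_symbol, int) algebra" where
  "Z_even n = subalgebra_on Z_algebra (Z_even_universe n)"

datatype partial_symbol = F nat | G

datatype relation_symbol = Approx nat

fun ego_partial_signature :: "nat \<Rightarrow> partial_symbol signature" where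
  "ego_partial_signature n (F i) = (if 1 < i \<and> i \<le> n then Some 1 else None)"
| "ego_partial_signature n G = Some 1"

fun ego_relation_signature :: "nat \<Rightarrow> relation_symbol signature" where
  "ego_relation_signature n (Approx m) = (if 1 \<le> m \<and> m \<le> n - 1 then Some 2 else None)"

definition f_partial :: "nat \<Rightarrow> nat \<Rightarrow> int \<Rightarrow> int option" where
  "f_partial n i a =
     (if a \<in> Z_even_universe n - {int i, - int i}
      then Some (if a = int i - 1 then int i else if a = - (int i - 1) then - int i else a)
      else None)"

text \<open>For \<open>n = 1\<close> this is the empty partial map.\<close>

definition g_partial :: "nat \<Rightarrow> int \<Rightarrow> int option" where
  "g_partial n a =
     (if a \<in> Z_even_universe n - {1, - 1}
      then Some (if a > 0 then a - 1 else a + 1)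
      else None)"

definition approx :: "nat \<Rightarrow> int \<Rightarrow> int \<Rightarrow> bool" where
  "approx m a b \<longleftrightarrow> a = b \<or> (a \<in> {- int m..int m} \<and> b \<in> {- int m..int m})"

fun ego_partial :: "nat \<Rightarrow> partial_symbol \<Rightarrow> int list \<Rightarrow> int option" where
  "ego_partial n (F i) [a] = f_partial n i a"
| "ego_partial n G [a] = g_partial n a"
| "ego_partial n _ _ = None"

fun ego_relation :: "nat \<Rightarrow> relation_symbol \<Rightarrow> int list set" where
  "ego_relation n (Approx m) =
     {[a, b] | a b. a \<in> Z_even_universe n \<and> b \<in> Z_even_universe n \<and> approx m a b}"

definition Z_even_ego :: "nat \<Rightarrow> (partial_symbol, relation_symbol, int) tstructure" where
  "Z_even_ego n =
     \<lparr>topo = discrete_topology (Z_even_universe n),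
      poper = ego_partial n,
      rels = ego_relation n\<rparr>"

end

theory Submission
  imports Defs "HOL-Analysis.T1_Spaces"
begin

text \<open>A homomorphism between subalgebras of \<open>Z\<^sub>2\<^sub>n\<close> is an odd strictly increasing map, and every such map is
  a composite of the \<open>f\<^sub>i\<close> and \<open>g\<close>: push the domain to the top of the chain, shift it down, push it up
  again. A subuniverse of \<open>Z\<^sub>2\<^sub>n \<times> Z\<^sub>2\<^sub>n\<close> is a rectangle \<open>U \<times> V\<close> together with the graph of an odd strictly
  increasing map lying above it; pushing that graph to the top turns the subuniverse into a part of some
  \<open>\<approx>\<^sub>m\<close>. So the alter ego entails every binary subuniverse, and since the median is a term operation,
  the Baker--Pixley argument and compactness show that a subalgebra of \<open>hom(X, Z\<^sub>2\<^sub>n)\<close> that determines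
  the structure of \<open>X\<close> is all of \<open>hom(X, Z\<^sub>2\<^sub>n)\<close>. This gives both the duality and injectivity. For
  fullness, a homomorphism \<open>\<alpha>\<close> on \<open>hom(X, Z\<^sub>2\<^sub>n)\<close> has, by compactness, the same sign as the evaluation at
  some point; as \<open>a = b\<close> iff \<open>(a \<rightarrow> b) \<and> (b \<rightarrow> a)\<close> is positive, \<open>\<alpha>\<close> is that evaluation followed by an
  embedding, hence an evaluation itself.\<close>

section \<open>The operations and the partial endomorphisms\<close>

text \<open>The obstacle: a subalgebra T of the homomorphisms of X is known through its own values
  only, while the moves along the chain must be valid for every homomorphism. What bridges this is
  the shape of the domains: \<open>G\<close> omits exactly the values 1 and -1, \<open>F i\<close>
  exactly i and -i. If no member of a determining T takes such a value at a point, the operation is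
  defined there, and then no homomorphism takes it either. The detour over the top of the chain
  comes from the operations at hand: \<open>F i\<close> raises a single level by one, and only into
  a free level, while \<open>G\<close> is the only operation that lowers values and it lowers all of
  them at once. The number m is n minus the number of pairs in the graph part: after pushing, that
  part fills the top levels and everything else stays between -m and m. The extremes m = 0 and m = n
  are equality and the full relation, so that the relation symbols run from 1 to n - 1. Since 0 is
  absent, every value has a sign. This gives the notion of a rigid pair its meaning, and it lets the
  sign of a term express equality in the proof of fullness.\<close>

lemma sugihara_signature_arity:
  assumes "sugihara_signature s = Some k" "length xs = k"
  obtains a where "s = Neg" "k = 1" "xs = [a]"
    | a b where "s \<in> {Meet, Join, Imp}" "k = 2" "xs = [a, b]"
  using assms by (cases s) (auto simp: length_Suc_conv numeral_2_eq_2)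

lemma Z_oper_binary_cases:
  assumes "s \<in> {Meet, Join, Imp}"
  shows "Z_oper s [a, b] \<in> {a, b, - a}"
  using assms by auto

lemma Z_oper_in_universe:
  assumes "sugihara_signature s = Some k" "length xs = k" "set xs \<subseteq> Z_even_universe n"
  shows "Z_oper s xs \<in> Z_even_universe n"
  using assms(1,2)
proof (cases rule: sugihara_signature_arity)
  case (1 a)
  then show ?thesis using assms(3) by (auto simp: Z_even_universe_def)
next
  case (2 a b)
  then show ?thesis using assms(3) Z_oper_binary_cases[of s a b]
    by (auto simp: Z_even_universe_def)
qed

text \<open>Every operation returns one of its arguments or the negative of the first, and the
  choice depends only on order comparisons between these elements. An odd order embedding of a
  symmetric set respects that choice; hence \<open>F i\<close> and \<open>G\<close> are partial
  endomorphisms.\<close>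

lemma Z_oper_odd_mono:
  assumes "sugihara_signature s = Some k" "length xs = k" "set xs \<subseteq> D"
    and "\<And>a. a \<in> D \<Longrightarrow> - a \<in> D \<and> e (- a) = - e a"
    and "strict_mono_on D e"
  shows "Z_oper s xs \<in> D" "Z_oper s (map e xs) = e (Z_oper s xs)"
proof -
  have "Z_oper s xs \<in> D \<and> Z_oper s (map e xs) = e (Z_oper s xs)"
    using assms(1,2)
  proof (cases rule: sugihara_signature_arity)
    case (1 a)
    then show ?thesis using assms(3,4) by auto
  next
    case (2 a b)
    then have D: "a \<in> D" "b \<in> D" "- a \<in> D" and n: "e (- a) = - e a"
      using assms(3,4) by auto
    have le: "e x \<le> e y \<longleftrightarrow> x \<le> y" if "x \<in> D" "y \<in> D" for x y
      using that assms(5) by (metis linorder_not_less order_le_less strict_mono_onD)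
    have "e (min x y) = min (e x) (e y)" "e (max x y) = max (e x) (e y)" if "x \<in> D" "y \<in> D" for x y
      using le[OF that] by (simp_all add: min_def max_def)
    moreover have "min x y \<in> D" "max x y \<in> D" if "x \<in> D" "y \<in> D" for x y
      using that by (simp_all add: min_def max_def)
    ultimately show ?thesis using 2 D n by (auto simp: le)
  qed
  then show "Z_oper s xs \<in> D" "Z_oper s (map e xs) = e (Z_oper s xs)" by auto
qed

text \<open>Domain and value of a symbol are separated into a set and a total map, so that
  composites need no option type. \<open>pval\<close> is meaningful on \<open>pdom\<close> only; for
  symbols outside the signature, such as \<open>F (n + 1)\<close>, its values may leave the
  universe.\<close>

definition pdom :: "nat \<Rightarrow> partial_symbol \<Rightarrow> int set" where
  "pdom n h = Z_even_universe n - (case h of F i \<Rightarrow> {int i, - int i} | G \<Rightarrow> {1, - 1})"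

definition pval :: "partial_symbol \<Rightarrow> int \<Rightarrow> int" where
  "pval h a = (case h of
     F i \<Rightarrow> if a = int i - 1 then int i else if a = - (int i - 1) then - int i else a
   | G \<Rightarrow> if a > 0 then a - 1 else a + 1)"

lemma ego_partial_unary: "ego_partial n h [a] = (if a \<in> pdom n h then Some (pval h a) else None)"
  by (cases h) (auto simp: pdom_def pval_def f_partial_def g_partial_def)

lemma ego_partial_signature_Some:
  assumes "ego_partial_signature n h = Some k"
  shows "k = 1"
  using assms by (cases h) (auto split: if_splits)

lemma ego_partial_SomeD:
  assumes "ego_partial n h xs = Some b"
  obtains a where "xs = [a]" "a \<in> pdom n h" "b = pval h a"
proof -
  consider "xs = []" | a where "xs = [a]" | a b ys where "xs = a # b # ys"
    by (metis neq_Nil_conv)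
  then show ?thesis using assms that by cases (cases h; auto simp: ego_partial_unary split: if_splits)+
qed

lemma pval_odd_mono:
  assumes "ego_partial_signature n h \<noteq> None"
  shows "a \<in> pdom n h \<Longrightarrow> - a \<in> pdom n h \<and> pval h (- a) = - pval h a"
    and "strict_mono_on (pdom n h) (pval h)"
    and "a \<in> pdom n h \<Longrightarrow> pval h a \<in> Z_even_universe n"
  using assms
  by (cases h; auto simp: pdom_def pval_def Z_even_universe_def strict_mono_on_def split: if_splits)+

lemma pdom_subset: "pdom n h \<subseteq> Z_even_universe n"
  by (auto simp: pdom_def)

text \<open>The only nontrivial block is convex and closed under negation. Comparisons across blocks
  therefore do not depend on representatives, and an operation applied inside the block stays
  there.\<close>

lemma Z_oper_approx:
  assumes "sugihara_signature s = Some k" "length xs = k" "length ys = k"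
    and "\<And>i. i < k \<Longrightarrow> approx m (xs ! i) (ys ! i)"
  shows "approx m (Z_oper s xs) (Z_oper s ys)"
  using assms(1,2)
proof (cases rule: sugihara_signature_arity)
  case (1 a)
  then show ?thesis using assms(3) assms(4)[of 0] by (auto simp: approx_def length_Suc_conv)
next
  case (2 a b)
  then obtain c d where "ys = [c, d]" using assms(3) by (auto simp: length_Suc_conv numeral_2_eq_2)
  then have "approx m a c" "approx m b d" using assms(4)[of 0] assms(4)[of 1] 2 by auto
  then show ?thesis using 2 \<open>ys = [c, d]\<close> by (auto simp: approx_def min_def max_def split: if_splits)
qed

section \<open>Structures determined by their homomorphisms\<close>

abbreviation ego_hom :: "nat \<Rightarrow> (partial_symbol, relation_symbol, 'x) tstructure \<Rightarrow> ('x \<Rightarrow> int) set" where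
  "ego_hom n X \<equiv> str_hom (ego_partial_signature n) (ego_relation_signature n) X (Z_even_ego n)"

lemma tuples_1: "tuples U (Suc 0) = (\<lambda>a. [a]) ` U"
  by (auto simp: tuples_def length_Suc_conv image_iff)

lemma tuples_2: "tuples U 2 = {[a, b] | a b. a \<in> U \<and> b \<in> U}"
  by (auto simp: tuples_def length_Suc_conv numeral_2_eq_2)

lemma Z_even_ego_simps [simp]:
  "topo (Z_even_ego n) = discrete_topology (Z_even_universe n)"
  "poper (Z_even_ego n) = ego_partial n"
  "rels (Z_even_ego n) = ego_relation n"
  by (auto simp: Z_even_ego_def)

lemma ego_hom_continuous:
  "u \<in> ego_hom n X \<Longrightarrow> continuous_map (topo X) (discrete_topology (Z_even_universe n)) u"
  by (simp add: str_hom_def)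

lemma ego_hom_PiE: "u \<in> ego_hom n X \<Longrightarrow> u \<in> points X \<rightarrow>\<^sub>E Z_even_universe n"
  by (simp add: str_hom_def)

lemma ego_hom_val: "u \<in> ego_hom n X \<Longrightarrow> x \<in> points X \<Longrightarrow> u x \<in> Z_even_universe n"
  using ego_hom_PiE by fastforce

lemma ego_signature_homI:
  assumes "u \<in> points X \<rightarrow>\<^sub>E points Y" "continuous_map (topo X) (topo Y) u"
    and "\<And>h x y. ego_partial_signature n h \<noteq> None \<Longrightarrow> x \<in> points X \<Longrightarrow> poper X h [x] = Some y \<Longrightarrow>
           poper Y h [u x] = Some (u y)"
    and "\<And>m x y. 1 \<le> m \<Longrightarrow> m \<le> n - 1 \<Longrightarrow> x \<in> points X \<Longrightarrow> y \<in> points X \<Longrightarrow>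
           [x, y] \<in> rels X (Approx m) \<Longrightarrow> [u x, u y] \<in> rels Y (Approx m)"
  shows "u \<in> str_hom (ego_partial_signature n) (ego_relation_signature n) X Y"
proof -
  have "poper Y h (map u xs) = Some (u y)"
    if h: "ego_partial_signature n h = Some k" and xs: "xs \<in> tuples (points X) k"
      and y: "poper X h xs = Some y"
    for h k xs y
  proof -
    have "k = 1" using h by (rule ego_partial_signature_Some)
    then obtain x where "xs = [x]" "x \<in> points X" using xs by (auto simp: tuples_1)
    then show ?thesis using h y assms(3)[of h x y] by simp
  qed
  moreover have "map u xs \<in> rels Y r"
    if r: "ego_relation_signature n r = Some k" and xs: "xs \<in> tuples (points X) k" "xs \<in> rels X r"
    for r k xs
  proof -
    obtain m where m: "r = Approx m" by (cases r)
    then have m': "1 \<le> m" "m \<le> n - 1" "k = 2" using r by (auto split: if_splits)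
    then obtain x y where "xs = [x, y]" "x \<in> points X" "y \<in> points X" using xs(1) by (auto simp: tuples_2)
    then show ?thesis using xs(2) m m' assms(4)[of m x y] by simp
  qed
  ultimately show ?thesis using assms(1,2) by (simp add: str_hom_def)
qed

lemma ego_signature_hom_poper:
  assumes "u \<in> str_hom (ego_partial_signature n) (ego_relation_signature n) X Y"
    "ego_partial_signature n h \<noteq> None" "x \<in> points X" "poper X h [x] = Some y"
  shows "poper Y h [u x] = Some (u y)"
proof -
  obtain k where k: "ego_partial_signature n h = Some k" using assms(2) by auto
  then have "k = 1" by (rule ego_partial_signature_Some)
  then have "[x] \<in> tuples (points X) k" using assms(3) by (simp add: tuples_1)
  then have "poper Y h (map u [x]) = Some (u y)"
    using assms(1,4) k unfolding str_hom_def by blast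
  then show ?thesis by simp
qed

lemma ego_signature_hom_rel:
  assumes "u \<in> str_hom (ego_partial_signature n) (ego_relation_signature n) X Y"
    "1 \<le> m" "m \<le> n - 1" "x \<in> points X" "y \<in> points X" "[x, y] \<in> rels X (Approx m)"
  shows "[u x, u y] \<in> rels Y (Approx m)"
proof -
  have r: "ego_relation_signature n (Approx m) = Some 2" using assms(2,3) by simp
  have "[x, y] \<in> tuples (points X) 2" using assms(4,5) by (simp add: tuples_def)
  then have "map u [x, y] \<in> rels Y (Approx m)"
    using assms(1,6) r unfolding str_hom_def by blast
  then show ?thesis by simp
qed

lemma ego_hom_poper:
  assumes "u \<in> ego_hom n X" "ego_partial_signature n h \<noteq> None" "x \<in> points X"
    "poper X h [x] = Some y"
  shows "u x \<in> pdom n h" "u y = pval h (u x)"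
  using ego_signature_hom_poper[OF assms] by (auto simp: ego_partial_unary split: if_splits)

lemma ego_hom_approx:
  assumes "u \<in> ego_hom n X" "1 \<le> m" "m \<le> n - 1" "x \<in> points X" "y \<in> points X"
    "[x, y] \<in> rels X (Approx m)"
  shows "approx m (u x) (u y)"
  using ego_signature_hom_rel[OF assms] by simp

lemma ego_homI:
  assumes "u \<in> points X \<rightarrow>\<^sub>E Z_even_universe n"
    and "continuous_map (topo X) (discrete_topology (Z_even_universe n)) u"
    and "\<And>h x y. ego_partial_signature n h \<noteq> None \<Longrightarrow> x \<in> points X \<Longrightarrow> poper X h [x] = Some y \<Longrightarrow>
           u x \<in> pdom n h \<and> u y = pval h (u x)"
    and "\<And>m x y. 1 \<le> m \<Longrightarrow> m \<le> n - 1 \<Longrightarrow> x \<in> points X \<Longrightarrow> y \<in> points X \<Longrightarrow>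
           [x, y] \<in> rels X (Approx m) \<Longrightarrow> approx m (u x) (u y)"
  shows "u \<in> ego_hom n X"
  using assms by (intro ego_signature_homI) (auto simp: ego_partial_unary PiE_mem)

text \<open>Sending x to the family of all t x embeds \<open>X\<close> in a power of the alter ego,
  with an image closed under the partial operations: points, domains and relations are detected by
  \<open>T\<close>. The values of the operations are covered by
  \<open>T \<subseteq> ego_hom n X\<close>.\<close>

definition determines ::
  "nat \<Rightarrow> ('x \<Rightarrow> int) set \<Rightarrow> (partial_symbol, relation_symbol, 'x) tstructure \<Rightarrow> bool" where
  "determines n T X \<longleftrightarrow> T \<subseteq> ego_hom n X \<and>
     (\<forall>x\<in>points X. \<forall>y\<in>points X. (\<forall>t\<in>T. t x = t y) \<longrightarrow> x = y) \<and>
     (\<forall>h. ego_partial_signature n h \<noteq> None \<longrightarrow> (\<forall>x\<in>points X.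
        (\<forall>t\<in>T. t x \<in> pdom n h) \<longrightarrow> (\<exists>y\<in>points X. poper X h [x] = Some y))) \<and>
     (\<forall>m. 1 \<le> m \<longrightarrow> m \<le> n - 1 \<longrightarrow> (\<forall>x\<in>points X. \<forall>y\<in>points X.
        (\<forall>t\<in>T. approx m (t x) (t y)) \<longrightarrow> [x, y] \<in> rels X (Approx m)))"

lemma determines_mono:
  "determines n E X \<Longrightarrow> E \<subseteq> T \<Longrightarrow> T \<subseteq> ego_hom n X \<Longrightarrow> determines n T X"
  unfolding determines_def by (meson subsetD)

lemma determines_poper:
  assumes "determines n T X" "ego_partial_signature n h \<noteq> None" "x \<in> points X"
    "\<And>t. t \<in> T \<Longrightarrow> t x \<in> pdom n h"
  shows "\<exists>y\<in>points X. poper X h [x] = Some y"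
  using assms unfolding determines_def by blast

lemma determines_approx:
  assumes "determines n T X" "1 \<le> m" "m \<le> n - 1" "x \<in> points X" "y \<in> points X"
    "\<And>t. t \<in> T \<Longrightarrow> approx m (t x) (t y)"
  shows "[x, y] \<in> rels X (Approx m)"
  using assms unfolding determines_def by blast

lemma determines_separates:
  assumes "determines n T X" "x \<in> points X" "y \<in> points X" "\<And>t. t \<in> T \<Longrightarrow> t x = t y"
  shows "x = y"
  using assms unfolding determines_def by blast

section \<open>Moving a point along the chain by the partial operations\<close>

definition odd_ext :: "(int \<Rightarrow> int) \<Rightarrow> int \<Rightarrow> int" where
  "odd_ext w a = (if a > 0 then w a else - w (- a))"

text \<open>For each level i one symbol omits exactly i and -i from its domain. If \<open>T\<close>
  avoided the level of u x, that operation would be defined at x, and u, which preserves it, would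
  avoid the level as well. So a set containing the absolute values of \<open>T\<close> at x contains
  those of all homomorphisms.\<close>

lemma determines_missing_value:
  assumes "determines n T X" "x \<in> points X" "u \<in> ego_hom n X"
  obtains t where "t \<in> T" "\<bar>t x\<bar> = \<bar>u x\<bar>"
proof -
  define i where "i = nat \<bar>u x\<bar>"
  have i: "1 \<le> i" "i \<le> n" "int i = \<bar>u x\<bar>"
    using ego_hom_val[OF assms(3,2)] by (auto simp: i_def Z_even_universe_def)
  define h where "h = (if i = 1 then G else F i)"
  have h: "ego_partial_signature n h \<noteq> None" using i by (auto simp: h_def)
  have dom: "a \<in> pdom n h \<longleftrightarrow> a \<in> Z_even_universe n \<and> \<bar>a\<bar> \<noteq> int i" for a
    using i by (auto simp: pdom_def h_def)
  have "\<exists>t\<in>T. \<bar>t x\<bar> = \<bar>u x\<bar>"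
  proof (rule ccontr)
    assume "\<not> ?thesis"
    then have "\<forall>t\<in>T. t x \<in> pdom n h"
      using assms(1,2) i by (auto simp: dom determines_def intro: ego_hom_val)
    then obtain y where "poper X h [x] = Some y"
      using assms(1,2) h unfolding determines_def by blast
    then have "u x \<in> pdom n h" by (rule ego_hom_poper(1)[OF assms(3) h assms(2)])
    then show False using i by (simp add: dom)
  qed
  then show ?thesis using that by blast
qed

lemma pval_push:
  assumes "a \<in> Z_even_universe n" "\<bar>a\<bar> \<noteq> s + 1" "s \<ge> 1"
  shows "pval (F (nat (s + 1))) a = odd_ext (\<lambda>t. if t = s then s + 1 else t) a"
  using assms by (auto simp: pval_def odd_ext_def Z_even_universe_def)

lemma pval_shift: "a \<noteq> 0 \<Longrightarrow> pval G a = odd_ext (\<lambda>t. t - 1) a"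
  by (auto simp: pval_def odd_ext_def)

lemma odd_ext_comp:
  assumes "a \<noteq> 0" "v \<bar>a\<bar> > 0"
  shows "odd_ext w (odd_ext v a) = odd_ext (w \<circ> v) a"
  using assms by (auto simp: odd_ext_def)

lemma odd_ext_cong: "w \<bar>a\<bar> = v \<bar>a\<bar> \<Longrightarrow> a \<noteq> 0 \<Longrightarrow> odd_ext w a = odd_ext v a"
  by (auto simp: odd_ext_def)

lemma abs_odd_ext: "a \<noteq> 0 \<Longrightarrow> w \<bar>a\<bar> > 0 \<Longrightarrow> \<bar>odd_ext w a\<bar> = w \<bar>a\<bar>"
  by (auto simp: odd_ext_def)

lemma Z_even_universe_nonzero: "a \<in> Z_even_universe n \<Longrightarrow> a \<noteq> 0"
  by (simp add: Z_even_universe_def)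

text \<open>A strictly increasing map that lowers no level is a composite of one-step moves. The
  highest level that has to rise goes first, because the place above it is then free; the total
  displacement decreases.\<close>

lemma push_inflationary:
  assumes "determines n (ego_hom n X) X" "S \<subseteq> {1..int n}" "x \<in> points X"
    and "\<And>u. u \<in> ego_hom n X \<Longrightarrow> \<bar>u x\<bar> \<in> S"
    and "strict_mono_on S w" "\<And>s. s \<in> S \<Longrightarrow> s \<le> w s \<and> w s \<le> int n"
  shows "\<exists>y\<in>points X. \<forall>u\<in>ego_hom n X. u y = odd_ext w (u x)"
  using assms(2-)
proof (induction "nat (\<Sum>s\<in>S. w s - s)" arbitrary: S x w rule: less_induct)
  case less
  have fin: "finite S" using less.prems(1) finite_subset by blast
  define M where "M = {s \<in> S. w s > s}"
  show ?case
  proof (cases "M = {}")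
    case True
    then have id: "w s = s" if "s \<in> S" for s
      using less.prems(5)[of s] that by (force simp: M_def)
    have "u x = odd_ext w (u x)" if "u \<in> ego_hom n X" for u
      using id[OF less.prems(3)[OF that]] by (auto simp: odd_ext_def split: if_splits)
    then show ?thesis using less.prems(2) by blast
  next
    case False
    have "finite M" using fin by (simp add: M_def)
    define s where "s = Max M"
    have "s \<in> M" using Max_in[OF \<open>finite M\<close> False] by (simp add: s_def)
    then have s: "s \<in> S" "s < w s" by (auto simp: M_def)
    have max: "w t = t" if "t \<in> S" "s < t" for t
      using that Max_ge[OF \<open>finite M\<close>, of t] less.prems(5)[of t] by (force simp: M_def s_def)
    have sn: "1 \<le> s" "s + 1 \<le> int n" using s less.prems(1,5) by (force, force)
    \<comment> \<open>Were s + 1 a level, maximality of s would give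
      \<open>w (s + 1) = s + 1 \<le> w s\<close>, against strict monotonicity.\<close>
    have notin: "s + 1 \<notin> S"
      using s max[of "s + 1"] strict_mono_onD[OF less.prems(4), of s "s + 1"] by force
    define v where "v = (\<lambda>t. if t = s then s + 1 else t)"
    define h where "h = F (nat (s + 1))"
    have h: "ego_partial_signature n h \<noteq> None" using sn by (auto simp: h_def)
    have dom: "u x \<in> pdom n h" if "u \<in> ego_hom n X" for u
      using less.prems(3)[OF that] notin sn ego_hom_val[OF that less.prems(2)]
      by (auto simp: pdom_def h_def abs_if add.commute split: if_splits)
    obtain z where z: "z \<in> points X" "poper X h [x] = Some z"
      using determines_poper[OF assms(1) h less.prems(2)] dom by blast
    have uz: "u z = odd_ext v (u x)" if "u \<in> ego_hom n X" for u
    proof -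
      have "u z = pval h (u x)" by (rule ego_hom_poper(2)[OF that h less.prems(2) z(2)])
      moreover have "\<bar>u x\<bar> \<noteq> s + 1" using less.prems(3)[OF that] notin by auto
      ultimately show ?thesis
        using pval_push[OF ego_hom_val[OF that less.prems(2)] _ sn(1)] by (simp add: h_def v_def)
    qed
    \<comment> \<open>What remains after the single move \<open>v\<close>: on the image of
      \<open>S\<close> under \<open>v\<close> this is \<open>w\<close> composed with the inverse of
      \<open>v\<close>.\<close>
    define w' where "w' = (\<lambda>t. if t = s + 1 then w s else w t)"
    define S' where "S' = v ` S"
    have S': "S' = insert (s + 1) (S - {s})" using s by (auto simp: S'_def v_def)
    have wv: "w' (v t) = w t" if "t \<in> S" for t
      using that notin by (auto simp: w'_def v_def)
    have inj: "inj_on v S" using notin by (auto simp: inj_on_def v_def)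
    have vle: "v t \<le> w t" if "t \<in> S" for t using that s less.prems(5)[of t] by (auto simp: v_def)
    have vmono: "v t < v t' \<longleftrightarrow> t < t'" if "t \<in> S" "t' \<in> S" for t t'
      using that notin by (cases "t' = s + 1"; cases "t = s + 1") (auto simp: v_def)
    have "(\<Sum>t\<in>S'. w' t - t) = (\<Sum>t\<in>S. w t - v t)"
      unfolding S'_def by (subst sum.reindex[OF inj]) (simp add: wv)
    also have "\<dots> < (\<Sum>t\<in>S. w t - t)"
      by (rule sum_strict_mono_ex1[OF fin]) (use s in \<open>auto simp: v_def\<close>)
    finally have lt: "(\<Sum>t\<in>S'. w' t - t) < (\<Sum>t\<in>S. w t - t)" .
    moreover have "0 \<le> (\<Sum>t\<in>S'. w' t - t)"
      by (rule sum_nonneg) (use vle wv in \<open>auto simp: S'_def\<close>)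
    ultimately have "nat (\<Sum>t\<in>S'. w' t - t) < nat (\<Sum>t\<in>S. w t - t)" by simp
    then have "\<exists>y\<in>points X. \<forall>u\<in>ego_hom n X. u y = odd_ext w' (u z)"
    proof (rule less.hyps)
      show "S' \<subseteq> {1..int n}" using less.prems(1) sn by (auto simp: S')
      show "z \<in> points X" by fact
      show "\<bar>u z\<bar> \<in> S'" if "u \<in> ego_hom n X" for u
      proof -
        have "v \<bar>u x\<bar> \<in> S'" using less.prems(3)[OF that] by (simp add: S'_def)
        moreover have "v \<bar>u x\<bar> > 0"
          using less.prems(3)[OF that] less.prems(1) sn by (force simp: v_def)
        moreover have "u x \<noteq> 0" using ego_hom_val[OF that less.prems(2)] by (rule Z_even_universe_nonzero)
        ultimately show ?thesis using uz[OF that] by (simp add: abs_odd_ext)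
      qed
      show "strict_mono_on S' w'"
        using less.prems(4) vmono wv by (auto simp: strict_mono_on_def S'_def)
      show "t \<le> w' t \<and> w' t \<le> int n" if "t \<in> S'" for t
        using that vle wv less.prems(5) by (auto simp: S'_def)
    qed
    then obtain y where y: "y \<in> points X" "\<And>u. u \<in> ego_hom n X \<Longrightarrow> u y = odd_ext w' (u z)" by blast
    have "u y = odd_ext w (u x)" if "u \<in> ego_hom n X" for u
    proof -
      have nz: "u x \<noteq> 0" using ego_hom_val[OF that less.prems(2)] by (rule Z_even_universe_nonzero)
      have "v \<bar>u x\<bar> > 0" using less.prems(3)[OF that] less.prems(1) sn by (force simp: v_def)
      then have "u y = odd_ext (w' \<circ> v) (u x)" using nz by (simp add: y(2)[OF that] uz[OF that] odd_ext_comp)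
      also have "\<dots> = odd_ext w (u x)"
        by (rule odd_ext_cong) (use nz wv[OF less.prems(3)[OF that]] in auto)
      finally show ?thesis .
    qed
    then show ?thesis using y(1) by blast
  qed
qed

text \<open>Level 1 is the only obstruction to \<open>G\<close>, and each of d successive shifts
  starts above it when all levels exceed d.\<close>

lemma push_down:
  assumes "determines n (ego_hom n X) X" "x \<in> points X"
    and "\<And>u. u \<in> ego_hom n X \<Longrightarrow> \<bar>u x\<bar> > int d"
  shows "\<exists>y\<in>points X. \<forall>u\<in>ego_hom n X. u y = odd_ext (\<lambda>t. t - int d) (u x)"
  using assms(3)
proof (induction d)
  case 0
  have "odd_ext (\<lambda>t. t - int 0) a = a" for a by (simp add: odd_ext_def)
  then show ?case using assms(2) by auto
next
  case (Suc d)
  then obtain y where y: "y \<in> points X" "\<And>u. u \<in> ego_hom n X \<Longrightarrow> u y = odd_ext (\<lambda>t. t - int d) (u x)"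
    by force
  have big: "\<bar>u y\<bar> > 1" if "u \<in> ego_hom n X" for u
    using Suc.prems[OF that] by (auto simp: y(2)[OF that] odd_ext_def split: if_splits)
  have "u y \<in> pdom n G" if "u \<in> ego_hom n X" for u
    using ego_hom_val[OF that y(1)] big[OF that] by (auto simp: pdom_def)
  then obtain z where z: "z \<in> points X" "poper X G [y] = Some z"
    using determines_poper[OF assms(1) _ y(1), of G] by auto
  have "u z = odd_ext (\<lambda>t. t - int (Suc d)) (u x)" if "u \<in> ego_hom n X" for u
  proof -
    have "u z = odd_ext (\<lambda>t. t - 1) (u y)"
      using ego_hom_poper(2)[OF that _ y(1) z(2)] big[OF that] by (auto simp: pval_shift)
    also have "\<dots> = odd_ext (\<lambda>t. t - int (Suc d)) (u x)"
      using Suc.prems[OF that] by (auto simp: y(2)[OF that] odd_ext_def)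
    finally show ?thesis .
  qed
  then show ?case using z(1) by blast
qed

text \<open>The hypothesis on levels concerns \<open>T\<close>, the conclusion all homomorphisms;
  \<open>determines_missing_value\<close> passes from one to the other. An arbitrary
  \<open>w\<close> may lower some levels and raise others, so the levels are first replaced by their
  ranks, from which \<open>w\<close> can only rise.\<close>

lemma push:
  assumes "determines n T X" "x \<in> points X" "S \<subseteq> {1..int n}"
    and "\<And>t. t \<in> T \<Longrightarrow> \<bar>t x\<bar> \<in> S"
    and "strict_mono_on S w" "w ` S \<subseteq> {1..int n}"
  shows "\<exists>y\<in>points X. \<forall>u\<in>ego_hom n X. \<bar>u x\<bar> \<in> S \<and> u y = odd_ext w (u x)"
proof -
  have D: "determines n (ego_hom n X) X"
    using assms(1) by (rule determines_mono) (use assms(1) in \<open>auto simp: determines_def\<close>)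
  have inS: "\<bar>u x\<bar> \<in> S" if "u \<in> ego_hom n X" for u
    using determines_missing_value[OF assms(1,2) that] assms(4) by metis
  have nz: "u x \<noteq> 0" if "u \<in> ego_hom n X" for u
    using ego_hom_val[OF that assms(2)] by (rule Z_even_universe_nonzero)
  have fin: "finite S" using assms(3) finite_subset by blast
  \<comment> \<open>\<open>r s\<close> is the rank of s, counted from 1, and d is the number of
    places below the top segment with as many elements as \<open>S\<close>; thus
    \<open>r s + d\<close> fills that segment.\<close>
  define r where "r = (\<lambda>s. int (card {t \<in> S. t \<le> s}))"
  define d where "d = n - card S"
  have cS: "card S \<le> n" using card_mono[OF _ assms(3)] by simp
  have r1: "r s \<ge> 1" if "s \<in> S" for s
  proof -
    have "card {t \<in> S. t \<le> s} > 0" using fin that by (subst card_gt_0_iff) auto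
    then show ?thesis by (simp add: r_def)
  qed
  have r2: "r s \<le> int (card S)" for s
    using card_mono[OF fin, of "{t \<in> S. t \<le> s}"] by (auto simp: r_def)
  have rmono: "strict_mono_on S r"
  proof (rule strict_mono_onI)
    fix s t assume st: "s \<in> S" "t \<in> S" "s < t"
    have "{p \<in> S. p \<le> s} \<subset> {p \<in> S. p \<le> t}"
    proof (rule psubsetI)
      have "t \<in> {p \<in> S. p \<le> t} - {p \<in> S. p \<le> s}" using st by simp
      then show "{p \<in> S. p \<le> s} \<noteq> {p \<in> S. p \<le> t}" by blast
    qed (use st in auto)
    then have "card {p \<in> S. p \<le> s} < card {p \<in> S. p \<le> t}"
      using fin by (intro psubset_card_mono) auto
    then show "r s < r t" by (simp add: r_def)
  qed
  \<comment> \<open>At most n - s levels lie above s, so at least \<open>card S - (n - s)\<close>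
    lie at or below it.\<close>
  have top: "s \<le> r s + int d" if "s \<in> S" for s
  proof -
    have "card S = card {t \<in> S. t \<le> s} + card {t \<in> S. s < t}"
      using fin by (subst card_Un_disjoint[symmetric]) (auto intro: arg_cong[where f = card])
    moreover have "card {t \<in> S. s < t} \<le> card {s<..int n}" using assms(3) by (intro card_mono) auto
    moreover have "card {s<..int n} = nat (int n - s)" by simp
    moreover have "s \<le> int n" using that assms(3) by auto
    ultimately show ?thesis using cS by (simp add: r_def d_def of_nat_diff)
  qed
  have "\<exists>y\<in>points X. \<forall>u\<in>ego_hom n X. u y = odd_ext (\<lambda>s. r s + int d) (u x)"
  proof (rule push_inflationary[OF D assms(3,2)])
    show "\<bar>u x\<bar> \<in> S" if "u \<in> ego_hom n X" for u by (rule inS[OF that])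
    show "strict_mono_on S (\<lambda>s. r s + int d)" using rmono by (simp add: strict_mono_on_def)
    show "s \<le> r s + int d \<and> r s + int d \<le> int n" if "s \<in> S" for s
      using top[OF that] r2[of s] cS by (simp add: d_def)
  qed
  then obtain y1 where y1: "y1 \<in> points X"
    "\<And>u. u \<in> ego_hom n X \<Longrightarrow> u y1 = odd_ext (\<lambda>s. r s + int d) (u x)" by blast
  have a1: "\<bar>u y1\<bar> = r \<bar>u x\<bar> + int d" if "u \<in> ego_hom n X" for u
    using y1(2)[OF that] r1[OF inS[OF that]] nz[OF that] by (simp add: abs_odd_ext)
  have "\<exists>y\<in>points X. \<forall>u\<in>ego_hom n X. u y = odd_ext (\<lambda>t. t - int d) (u y1)"
    by (rule push_down[OF D y1(1)]) (use a1 r1[OF inS] in force)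
  then obtain y2 where y2: "y2 \<in> points X"
    "\<And>u. u \<in> ego_hom n X \<Longrightarrow> u y2 = odd_ext (\<lambda>t. t - int d) (u y1)" by blast
  have e2: "u y2 = odd_ext r (u x)" if "u \<in> ego_hom n X" for u
  proof -
    have "u y2 = odd_ext ((\<lambda>t. t - int d) \<circ> (\<lambda>s. r s + int d)) (u x)"
      using y2(2)[OF that] y1(2)[OF that] r1[OF inS[OF that]] nz[OF that] by (simp add: odd_ext_comp)
    then show ?thesis by (simp add: comp_def)
  qed
  \<comment> \<open>The levels are now ranks; \<open>q\<close> recovers the original level from its
    rank.\<close>
  define q where "q = inv_into S r"
  have inj: "inj_on r S" using rmono by (simp add: strict_mono_on_imp_inj_on)
  have q: "q (r s) = s" if "s \<in> S" for s using that inj by (simp add: q_def)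
  have rle: "r s < r t \<longleftrightarrow> s < t" if "s \<in> S" "t \<in> S" for s t
    using strict_mono_on_less[OF rmono that] .
  \<comment> \<open>\<open>w\<close> maps the \<open>r s\<close> levels up to s injectively into
    \<open>{1..w s}\<close>.\<close>
  have infl: "r s \<le> w s" if "s \<in> S" for s
  proof -
    have "card (w ` {t \<in> S. t \<le> s}) \<le> card {1..w s}"
      using assms(5,6) that by (intro card_mono) (auto simp: strict_mono_on_leD)
    moreover have "card (w ` {t \<in> S. t \<le> s}) = card {t \<in> S. t \<le> s}"
      using strict_mono_on_imp_inj_on[OF assms(5)] by (intro card_image) (auto simp: inj_on_def)
    moreover have "w s \<ge> 1" using assms(6) that by auto
    ultimately show ?thesis by (simp add: r_def)
  qed
  have "\<exists>y\<in>points X. \<forall>u\<in>ego_hom n X. u y = odd_ext (w \<circ> q) (u y2)"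
  proof (rule push_inflationary[OF D _ y2(1)])
    have "r s \<le> int n" for s using r2[of s] cS by linarith
    then show "r ` S \<subseteq> {1..int n}" using r1 by auto
    show "\<bar>u y2\<bar> \<in> r ` S" if "u \<in> ego_hom n X" for u
      using e2[OF that] r1[OF inS[OF that]] nz[OF that] inS[OF that] by (simp add: abs_odd_ext)
    show "strict_mono_on (r ` S) (w \<circ> q)"
      using assms(5) by (auto simp: strict_mono_on_def q rle)
    show "s \<le> (w \<circ> q) s \<and> (w \<circ> q) s \<le> int n" if "s \<in> r ` S" for s
      using that infl assms(6) by (auto simp: q)
  qed
  then obtain y where y: "y \<in> points X" "\<And>u. u \<in> ego_hom n X \<Longrightarrow> u y = odd_ext (w \<circ> q) (u y2)" by blast
  have "u y = odd_ext w (u x)" if "u \<in> ego_hom n X" for u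
  proof -
    have "u y = odd_ext ((w \<circ> q) \<circ> r) (u x)"
      using y(2)[OF that] e2[OF that] r1[OF inS[OF that]] nz[OF that] by (simp add: odd_ext_comp)
    also have "\<dots> = odd_ext w (u x)"
      by (rule odd_ext_cong) (use nz[OF that] q[OF inS[OF that]] in auto)
    finally show ?thesis .
  qed
  then show ?thesis using y(1) inS by blast
qed

section \<open>Binary subuniverses\<close>

text \<open>Closure is stated on pairs of numbers, so that \<open>S\<close> can be the set of joint
  values of a subalgebra of homomorphisms at two points.\<close>

locale binary_subuniverse =
  fixes n :: nat and S :: "(int \<times> int) set"
  assumes universe: "(a, b) \<in> S \<Longrightarrow> a \<in> Z_even_universe n \<and> b \<in> Z_even_universe n"
    and Neg: "(a, b) \<in> S \<Longrightarrow> (- a, - b) \<in> S"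
    and Meet: "(a, b) \<in> S \<Longrightarrow> (c, d) \<in> S \<Longrightarrow> (min a c, min b d) \<in> S"
    and Join: "(a, b) \<in> S \<Longrightarrow> (c, d) \<in> S \<Longrightarrow> (max a c, max b d) \<in> S"
    and Imp: "(a, b) \<in> S \<Longrightarrow> (c, d) \<in> S \<Longrightarrow>
      (if a \<le> c then max (- a) c else min (- a) c, if b \<le> d then max (- b) d else min (- b) d) \<in> S"
begin

text \<open>This is the graph part of \<open>S\<close>, where the sign of one coordinate forces that
  of the other. The remaining positive pairs occur with all four sign patterns and belong to the
  rectangle.\<close>

definition rigid :: "(int \<times> int) set" where
  "rigid = {(a, b) \<in> S. a > 0 \<and> b > 0 \<and> (a, - b) \<notin> S}"

lemma nonzero: "(a, b) \<in> S \<Longrightarrow> a \<noteq> 0 \<and> b \<noteq> 0"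
  using universe by (force simp: Z_even_universe_def)

text \<open>The term \<open>a \<rightarrow> a\<close> is the absolute value.\<close>

lemma abs_mem: "(a, b) \<in> S \<Longrightarrow> (\<bar>a\<bar>, \<bar>b\<bar>) \<in> S"
  using Imp[of a b a b] by (simp add: max_def abs_if split: if_splits)

text \<open>With opposite signs, the pair or its negative would be
  \<open>(\<bar>a\<bar>, - \<bar>b\<bar>)\<close>, which rigidity excludes.\<close>

lemma rigid_sign:
  assumes "(a, b) \<in> S" "(\<bar>a\<bar>, \<bar>b\<bar>) \<in> rigid"
  shows "(a > 0 \<and> b > 0) \<or> (a < 0 \<and> b < 0)"
  using assms Neg[OF assms(1)] by (auto simp: rigid_def abs_if split: if_splits)

text \<open>The meet with \<open>(c, d)\<close> brings the first coordinate down to c, and the join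
  with \<open>(- c, - d)\<close> brings the second one up to -d. So mixed signs are inherited by
  smaller positive pairs.\<close>

lemma mixed_below:
  assumes "(a, - b) \<in> S" "(c, d) \<in> S" "0 < c" "c \<le> a" "0 < d" "d \<le> b"
  shows "(c, - d) \<in> S"
proof -
  have "(c, - b) \<in> S" using Meet[OF assms(1,2)] assms(3-) by (simp add: min_def split: if_splits)
  then show ?thesis using Join[OF _ Neg[OF assms(2)], of c "- b"] assms(3-)
    by (simp add: max_def split: if_splits)
qed

text \<open>Coordinates can be exchanged between any two pairs that occur with all signs, so these
  pairs form a product set. Which term does it depends on how the pairs compare.\<close>

lemma mixed_rectangle:
  assumes "(a, b) \<in> S" "(a, - b) \<in> S" "(c, d) \<in> S" "(c, - d) \<in> S" "0 < a" "0 < b" "0 < c" "0 < d"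
  shows "(a, d) \<in> S \<and> (a, - d) \<in> S"
proof (cases "a \<le> c"; cases "b \<le> d")
  assume "a \<le> c" "b \<le> d"
  have "(a, - d) \<in> S" using Meet[OF assms(1,4)] \<open>a \<le> c\<close> \<open>b \<le> d\<close> assms(5-)
    by (simp add: min_def split: if_splits)
  moreover have "(- c, d) \<in> S" using Neg[OF assms(4)] by simp
  then have "(- a, d) \<in> S" using Join[OF _ Neg[OF assms(1)], of "- c" d] \<open>a \<le> c\<close> \<open>b \<le> d\<close> assms(5-)
    by (simp add: max_def split: if_splits)
  then have "(a, d) \<in> S" using Join[OF \<open>(- a, d) \<in> S\<close> assms(1)] \<open>b \<le> d\<close> assms(5-)
    by (simp add: max_def split: if_splits)
  ultimately show ?thesis by simp
next
  assume "a \<le> c" "\<not> b \<le> d"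
  then have "(a, d) \<in> S" using Meet[OF assms(1,3)] by (simp add: min_def split: if_splits)
  then show ?thesis using mixed_below[OF assms(2) \<open>(a, d) \<in> S\<close>] assms(5-) \<open>\<not> b \<le> d\<close> by simp
next
  assume "\<not> a \<le> c" "b \<le> d"
  then have ad: "(a, d) \<in> S" using Join[OF assms(1,3)] by (simp add: max_def split: if_splits)
  have "(a, - d) \<in> S"
  proof (cases "b = d")
    case False
    \<comment> \<open>As d > b, the implication from \<open>(a, d)\<close> to \<open>(a, b)\<close>
      gives \<open>a \<rightarrow> a = a\<close> in the first coordinate and
      \<open>min (- d) b = - d\<close> in the second.\<close>
    then show ?thesis using Imp[OF ad assms(1)] \<open>b \<le> d\<close> assms(5-)
      by (simp add: max_def min_def split: if_splits)
  qed (use assms(2) in simp)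
  then show ?thesis using ad by simp
next
  assume "\<not> a \<le> c" "\<not> b \<le> d"
  have "(a, - d) \<in> S" using Join[OF assms(2,4)] \<open>\<not> a \<le> c\<close> \<open>\<not> b \<le> d\<close> assms(5-)
    by (simp add: max_def split: if_splits)
  moreover have "(a, d) \<in> S" using Join[OF \<open>(a, - d) \<in> S\<close> assms(3)] \<open>\<not> a \<le> c\<close> assms(5-)
    by (simp add: max_def split: if_splits)
  ultimately show ?thesis by simp
qed

text \<open>If neither pair lies strictly below the other, one implication changes the relative sign of the
  two coordinates.\<close>

lemma mixed_of_incomparable:
  assumes "(a, b) \<in> S" "(c, d) \<in> S" "0 < a" "0 < b" "0 < c" "0 < d" "a \<le> c" "d \<le> b"
    "(a, b) \<noteq> (c, d)"
  shows "(a, - b) \<in> S \<and> (c, - d) \<in> S"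
proof -
  have cb: "(c, b) \<in> S" using Join[OF assms(1,2)] assms(7,8) by (simp add: max_def split: if_splits)
  have "(c, - b) \<in> S"
  proof (cases "d = b")
    case True
    then have "a < c" using assms(7,9) by simp
    then have "(- c, b) \<in> S" using Imp[OF assms(2,1)] True assms(3-)
      by (simp add: max_def min_def split: if_splits)
    then show ?thesis using Neg by fastforce
  next
    case False
    then show ?thesis using Imp[OF assms(1,2)] assms(3-8) by (simp add: max_def min_def split: if_splits)
  qed
  then show ?thesis using mixed_below[OF \<open>(c, - b) \<in> S\<close>] assms by blast
qed

text \<open>Incomparability would give \<open>(a, b)\<close> mixed signs, and a mixed pair above
  would hand its signs down by \<open>mixed_below\<close>. So the rigid pairs are a chain lying
  above all other positive pairs, which is why they can be pushed to the top.\<close>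

lemma rigid_comparable:
  assumes "(a, b) \<in> rigid" "(c, d) \<in> S" "0 < c" "0 < d"
  shows "(c < a \<and> d < b) \<or> (c = a \<and> d = b) \<or> (a < c \<and> b < d \<and> (c, d) \<in> rigid)"
proof -
  have ab: "(a, b) \<in> S" "0 < a" "0 < b" "(a, - b) \<notin> S" using assms(1) by (auto simp: rigid_def)
  consider "(c, d) = (a, b)" | "c < a \<and> d < b" | "a < c \<and> b < d"
    | "a \<le> c" "d \<le> b" "(c, d) \<noteq> (a, b)" | "c \<le> a" "b \<le> d" "(c, d) \<noteq> (a, b)"
    by force
  then show ?thesis
  proof cases
    case 3
    then have "(c, - d) \<notin> S" using mixed_below[of c d a b] ab assms(2-) by auto
    then show ?thesis using 3 assms(2-) by (auto simp: rigid_def)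
  next
    case 4
    then show ?thesis using mixed_of_incomparable[OF ab(1) assms(2)] ab assms(3-) by auto
  next
    case 5
    then show ?thesis using mixed_of_incomparable[OF assms(2) ab(1)] ab assms(3-) by auto
  qed auto
qed

lemma finite_rigid: "finite rigid"
proof (rule finite_subset)
  show "rigid \<subseteq> {1..int n} \<times> {1..int n}"
    using universe by (force simp: rigid_def Z_even_universe_def)
qed simp

text \<open>Both maps push the rigid coordinates, in order, to the top of the chain; there the two
  coordinates of a rigid pair agree.\<close>

definition lift1 :: "int \<Rightarrow> int" where
  "lift1 a = (if a \<in> fst ` rigid then int n - int (card {p \<in> rigid. a < fst p}) else a)"

definition lift2 :: "int \<Rightarrow> int" where
  "lift2 b = (if b \<in> snd ` rigid then int n - int (card {p \<in> rigid. b < snd p}) else b)"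

text \<open>The closure conditions are symmetric in the coordinates, so facts on
  \<open>lift2\<close> can be read off those on \<open>lift1\<close> for the swapped
  relation.\<close>

lemma converse_binary_subuniverse: "binary_subuniverse n (prod.swap ` S)"
proof -
  have mem: "(b, a) \<in> prod.swap ` S \<longleftrightarrow> (a, b) \<in> S" for a b by force
  show ?thesis
    by (unfold_locales; unfold mem)
      (erule Neg | erule (1) Meet | erule (1) Join | erule (1) Imp | blast dest: universe)+
qed

text \<open>The definition of \<open>rigid\<close> puts the sign on the second coordinate; negating
  the pair moves it to the first.\<close>

lemma rigid_converse: "binary_subuniverse.rigid (prod.swap ` S) = prod.swap ` rigid"
proof -
  have mem: "(b, a) \<in> prod.swap ` A \<longleftrightarrow> (a, b) \<in> A" for a b and A :: "(int \<times> int) set" by force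
  have "(b, - a) \<in> S \<longleftrightarrow> (- b, a) \<in> S" for a b using Neg[of b "- a"] Neg[of "- b" a] by auto
  then show ?thesis
    unfolding binary_subuniverse.rigid_def[OF converse_binary_subuniverse] rigid_def
    by (auto simp: mem intro!: set_eqI)
qed

lemma lift1_converse: "binary_subuniverse.lift1 n (prod.swap ` S) = lift2"
proof
  fix b
  have "card {p \<in> prod.swap ` rigid. b < fst p} = card (prod.swap ` {p \<in> rigid. b < snd p})"
    by (rule arg_cong[where f = card]) auto
  also have "\<dots> = card {p \<in> rigid. b < snd p}" by (rule card_image) simp
  finally have "card {p \<in> prod.swap ` rigid. b < fst p} = card {p \<in> rigid. b < snd p}" .
  then show "binary_subuniverse.lift1 n (prod.swap ` S) b = lift2 b"
    unfolding binary_subuniverse.lift1_def[OF converse_binary_subuniverse] rigid_converse lift2_def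
    by (simp add: image_image)
qed

text \<open>Between 0 and \<open>card rigid - 1\<close> rigid pairs lie above a rigid coordinate, so
  these coordinates land in the top \<open>card rigid\<close> places.\<close>

lemma lift1_rigid:
  assumes "a \<in> fst ` rigid"
  shows "int n - int (card rigid) < lift1 a" "lift1 a \<le> int n"
proof -
  obtain p where p: "p \<in> rigid" "fst p = a" using assms by auto
  have "card {p \<in> rigid. a < fst p} < card rigid"
    by (rule psubset_card_mono[OF finite_rigid]) (use p in auto)
  then show "int n - int (card rigid) < lift1 a" "lift1 a \<le> int n"
    using assms by (auto simp: lift1_def)
qed

lemma inj_on_fst_rigid: "inj_on fst rigid"
proof (rule inj_onI)
  fix p q assume pq: "p \<in> rigid" "q \<in> rigid" "fst p = fst q"
  then have "(fst q, snd q) \<in> S" "0 < fst q" "0 < snd q" "(fst p, snd p) \<in> rigid"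
    by (auto simp: rigid_def)
  then show "p = q" using rigid_comparable[of "fst p" "snd p" "fst q" "snd q"] pq(3)
    by (auto simp: prod_eq_iff)
qed

text \<open>Such a coordinate is strictly below all rigid ones, which are \<open>card rigid\<close>
  many by injectivity of \<open>fst\<close>. Hence the coordinates that \<open>lift1\<close> fixes
  leave the top places free.\<close>

lemma not_rigid_le:
  assumes "(a, b) \<in> S" "0 < a" "a \<notin> fst ` rigid"
  shows "a \<le> int n - int (card rigid)"
proof -
  have "(a, \<bar>b\<bar>) \<in> S" "0 < \<bar>b\<bar>" using abs_mem[OF assms(1)] nonzero[OF assms(1)] assms(2) by auto
  then have "a < c" if "(c, d) \<in> rigid" for c d
    using rigid_comparable[OF that, of a "\<bar>b\<bar>"] that assms(2,3) by force
  moreover have "c \<le> int n" if "(c, d) \<in> rigid" for c d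
    using that universe by (force simp: rigid_def Z_even_universe_def)
  ultimately have "fst ` rigid \<subseteq> {a<..int n}" by force
  then have "card (fst ` rigid) \<le> card {a<..int n}" by (intro card_mono) auto
  moreover have "card (fst ` rigid) = card rigid" by (rule card_image[OF inj_on_fst_rigid])
  moreover have "a \<le> int n" using universe[OF assms(1)] by (simp add: Z_even_universe_def)
  ultimately show ?thesis by simp
qed

lemma lift1_strict_mono: "strict_mono_on {a \<in> fst ` S. 0 < a} lift1"
proof (rule strict_mono_onI)
  fix a c assume ac: "a \<in> {a \<in> fst ` S. 0 < a}" "c \<in> {a \<in> fst ` S. 0 < a}" "a < c"
  then obtain b d where bd: "(a, b) \<in> S" "(c, d) \<in> S" "0 < a" "0 < c" by auto
  consider "a \<in> fst ` rigid" "c \<in> fst ` rigid" | "a \<notin> fst ` rigid" "c \<in> fst ` rigid"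
    | "a \<notin> fst ` rigid" "c \<notin> fst ` rigid" | "a \<in> fst ` rigid" "c \<notin> fst ` rigid" by blast
  then show "lift1 a < lift1 c"
  proof cases
    case 1
    have "card {p \<in> rigid. c < fst p} < card {p \<in> rigid. a < fst p}"
    proof (rule psubset_card_mono)
      obtain q where "q \<in> rigid" "fst q = c" using 1 by auto
      then have "q \<in> {p \<in> rigid. a < fst p} - {p \<in> rigid. c < fst p}" using ac by simp
      then show "{p \<in> rigid. c < fst p} \<subset> {p \<in> rigid. a < fst p}" using ac(3) by force
    qed (simp add: finite_rigid)
    then show ?thesis using 1 by (simp add: lift1_def)
  next
    case 2
    then show ?thesis using not_rigid_le[OF bd(1,3)] lift1_rigid[of c] by (simp add: lift1_def)
  next
    case 3
    then show ?thesis using ac by (simp add: lift1_def)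
  next
    case 4
    \<comment> \<open>This case cannot occur: a pair above a rigid one is rigid.\<close>
    then obtain e where "(a, e) \<in> rigid" by force
    moreover have "(c, \<bar>d\<bar>) \<in> S" "0 < \<bar>d\<bar>" using abs_mem[OF bd(2)] nonzero[OF bd(2)] bd by auto
    ultimately have "(c, \<bar>d\<bar>) \<in> rigid" using rigid_comparable[of a e c "\<bar>d\<bar>"] ac bd by auto
    then show ?thesis using 4 by force
  qed
qed

lemma card_rigid_le: "card rigid \<le> n"
proof -
  have "card rigid = card (fst ` rigid)" by (rule card_image[OF inj_on_fst_rigid, symmetric])
  also have "\<dots> \<le> card {1..int n}"
    using universe by (intro card_mono) (force simp: rigid_def Z_even_universe_def)+
  finally show ?thesis by simp
qed

lemma lift1_range:
  assumes "a \<in> fst ` S" "0 < a"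
  shows "lift1 a \<in> {1..int n}"
proof (cases "a \<in> fst ` rigid")
  case True
  then show ?thesis using lift1_rigid[OF True] card_rigid_le by simp
next
  case False
  then show ?thesis using assms universe by (force simp: lift1_def Z_even_universe_def)
qed

text \<open>Rigid pairs are ordered alike in both coordinates, so the same ones lie above a and
  above b.\<close>

lemma lift_rigid_eq:
  assumes "(a, b) \<in> rigid"
  shows "lift1 a = lift2 b"
proof -
  have "a < fst p \<longleftrightarrow> b < snd p" if "p \<in> rigid" for p
  proof -
    have "(fst p, snd p) \<in> S" "0 < fst p" "0 < snd p" using that by (auto simp: rigid_def)
    then show ?thesis using rigid_comparable[OF assms, of "fst p" "snd p"] by auto
  qed
  then have "{p \<in> rigid. a < fst p} = {p \<in> rigid. b < snd p}" by blast
  moreover have "a \<in> fst ` rigid" "b \<in> snd ` rigid" using assms by force+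
  ultimately show ?thesis by (simp add: lift1_def lift2_def)
qed

text \<open>By \<open>rigid_comparable\<close>, a positive pair sharing a coordinate with a rigid
  pair is equal to it.\<close>

lemma not_rigid_iff:
  assumes "(a, b) \<in> S" "0 < a" "0 < b" "(a, b) \<notin> rigid"
  shows "a \<notin> fst ` rigid" "b \<notin> snd ` rigid"
proof -
  have "a \<noteq> c \<and> b \<noteq> d" if "(c, d) \<in> rigid" for c d
    using rigid_comparable[OF that assms(1-3)] assms(4) that by auto
  then show "a \<notin> fst ` rigid" "b \<notin> snd ` rigid" by force+
qed

lemma lift2_rigid:
  assumes "b \<in> snd ` rigid"
  shows "int n - int (card rigid) < lift2 b"
proof -
  interpret C: binary_subuniverse n "prod.swap ` S" by (rule converse_binary_subuniverse)
  show ?thesis using C.lift1_rigid[of b] assms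
    by (simp add: rigid_converse lift1_converse image_image card_image)
qed

lemma not_rigid_le2:
  assumes "(a, b) \<in> S" "0 < b" "b \<notin> snd ` rigid"
  shows "b \<le> int n - int (card rigid)"
proof -
  interpret C: binary_subuniverse n "prod.swap ` S" by (rule converse_binary_subuniverse)
  show ?thesis using C.not_rigid_le[of b a] assms
    by (simp add: rigid_converse lift1_converse image_image card_image)
qed

text \<open>Over a rigid pair the two lifts coincide; otherwise both coordinates are fixed and
  bounded by \<open>n - card rigid\<close>. Together with \<open>mem_of_approx_lift\<close> this
  describes \<open>S\<close> as the inverse image of one congruence within the product of its
  projections.\<close>

lemma approx_lift:
  assumes "(a, b) \<in> S"
  shows "approx (n - card rigid) (odd_ext lift1 a) (odd_ext lift2 b)"
proof -
  have pos: "(\<bar>a\<bar>, \<bar>b\<bar>) \<in> S" "0 < \<bar>a\<bar>" "0 < \<bar>b\<bar>"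
    using abs_mem[OF assms] nonzero[OF assms] by auto
  show ?thesis
  proof (cases "(\<bar>a\<bar>, \<bar>b\<bar>) \<in> rigid")
    case True
    then show ?thesis using rigid_sign[OF assms True] lift_rigid_eq[OF True]
      by (auto simp: approx_def odd_ext_def)
  next
    case False
    note N = not_rigid_iff[OF pos False]
    then have "lift1 \<bar>a\<bar> = \<bar>a\<bar>" "lift2 \<bar>b\<bar> = \<bar>b\<bar>" by (simp_all only: lift1_def lift2_def if_False)
    then have "odd_ext lift1 a = a" "odd_ext lift2 b = b"
      using nonzero[OF assms] by (auto simp: odd_ext_def)
    moreover have "\<bar>a\<bar> \<le> int n - int (card rigid)" "\<bar>b\<bar> \<le> int n - int (card rigid)"
      using not_rigid_le[OF pos(1,2) N(1)] not_rigid_le2[OF pos(1,3) N(2)] by auto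
    ultimately show ?thesis by (auto simp: approx_def)
  qed
qed

text \<open>p and q are only known to occur in \<open>S\<close> separately. If one of them is rigid
  up to sign, its lift exceeds the bound, so the lifts are equal, the other is rigid too, and
  injectivity of \<open>lift1\<close> matches them. If neither is, both come from the
  rectangle.\<close>

lemma mem_of_approx_lift:
  assumes p: "(p, b) \<in> S" and q: "(a, q) \<in> S"
    and approx: "approx (n - card rigid) (odd_ext lift1 p) (odd_ext lift2 q)"
  shows "(p, q) \<in> S"
proof -
  interpret C: binary_subuniverse n "prod.swap ` S" by (rule converse_binary_subuniverse)
  have p': "(\<bar>p\<bar>, \<bar>b\<bar>) \<in> S" "0 < \<bar>p\<bar>" "0 < \<bar>b\<bar>" using abs_mem[OF p] nonzero[OF p] by auto
  have q': "(\<bar>a\<bar>, \<bar>q\<bar>) \<in> S" "0 < \<bar>a\<bar>" "0 < \<bar>q\<bar>" using abs_mem[OF q] nonzero[OF q] by auto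
  have "\<bar>p\<bar> \<in> {a \<in> fst ` S. 0 < a}" "\<bar>q\<bar> \<in> {a \<in> snd ` S. 0 < a}" using p' q' by force+
  have l1: "\<bar>odd_ext lift1 p\<bar> = lift1 \<bar>p\<bar>"
    using lift1_range[of "\<bar>p\<bar>"] p' nonzero[OF p] by (intro abs_odd_ext) force+
  have "\<bar>q\<bar> \<in> fst ` prod.swap ` S" using q' by force
  then have l2: "\<bar>odd_ext lift2 q\<bar> = lift2 \<bar>q\<bar>"
    using C.lift1_range[of "\<bar>q\<bar>"] q' nonzero[OF q] by (intro abs_odd_ext) (auto simp: lift1_converse)
  have eq: "\<bar>p\<bar> \<in> fst ` rigid \<or> \<bar>q\<bar> \<in> snd ` rigid \<Longrightarrow> odd_ext lift1 p = odd_ext lift2 q"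
  proof -
    assume "\<bar>p\<bar> \<in> fst ` rigid \<or> \<bar>q\<bar> \<in> snd ` rigid"
    then have "int (n - card rigid) < \<bar>odd_ext lift1 p\<bar> \<or> int (n - card rigid) < \<bar>odd_ext lift2 q\<bar>"
      unfolding l1 l2 of_nat_diff[OF card_rigid_le]
      using lift1_rigid(1)[of "\<bar>p\<bar>"] lift2_rigid[of "\<bar>q\<bar>"] by blast
    then show ?thesis using approx by (auto simp: approx_def)
  qed
  show ?thesis
  proof (cases "\<bar>p\<bar> \<in> fst ` rigid \<or> \<bar>q\<bar> \<in> snd ` rigid")
    case True
    note E = eq[OF True]
    have both: "\<bar>p\<bar> \<in> fst ` rigid \<and> \<bar>q\<bar> \<in> snd ` rigid"
    proof (rule ccontr)
      assume "\<not> ?thesis"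
      then consider "\<bar>p\<bar> \<in> fst ` rigid" "\<bar>q\<bar> \<notin> snd ` rigid" | "\<bar>p\<bar> \<notin> fst ` rigid" "\<bar>q\<bar> \<in> snd ` rigid"
        using True by blast
      then show False
      proof cases
        case 1
        then show False using lift1_rigid(1)[of "\<bar>p\<bar>"] not_rigid_le2[OF q'(1,3)] E l1 l2
          by (simp add: lift2_def)
      next
        case 2
        then show False using lift2_rigid[of "\<bar>q\<bar>"] not_rigid_le[OF p'(1,2)] E l1 l2
          by (simp add: lift1_def)
      qed
    qed
    then obtain c d where cd: "(\<bar>p\<bar>, d) \<in> rigid" "(c, \<bar>q\<bar>) \<in> rigid" by force
    have "lift1 c = lift1 \<bar>p\<bar>" using lift_rigid_eq[OF cd(2)] E l1 l2 by simp
    moreover have "c \<in> {a \<in> fst ` S. 0 < a}" using cd(2) by (force simp: rigid_def)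
    ultimately have "c = \<bar>p\<bar>"
      using strict_mono_on_imp_inj_on[OF lift1_strict_mono] \<open>\<bar>p\<bar> \<in> {a \<in> fst ` S. 0 < a}\<close>
      by (meson inj_onD)
    then have R: "(\<bar>p\<bar>, \<bar>q\<bar>) \<in> S" using cd(2) by (simp add: rigid_def)
    \<comment> \<open>\<open>odd_ext\<close> keeps signs where the lift is positive, so equal lifts
      force equal signs of p and q.\<close>
    have "lift1 \<bar>p\<bar> > 0" "lift2 \<bar>q\<bar> > 0"
      using lift1_range[of "\<bar>p\<bar>"] \<open>\<bar>p\<bar> \<in> {a \<in> fst ` S. 0 < a}\<close> E l1 l2 by auto
    then have "p > 0 \<longleftrightarrow> q > 0" using E nonzero[OF p] nonzero[OF q]
      by (auto simp: odd_ext_def split: if_splits)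
    then show ?thesis using R Neg[OF R] by (auto simp: abs_if split: if_splits)
  next
    case False
    then have "(\<bar>p\<bar>, \<bar>b\<bar>) \<notin> rigid" "(\<bar>a\<bar>, \<bar>q\<bar>) \<notin> rigid" by force+
    then have "(\<bar>p\<bar>, - \<bar>b\<bar>) \<in> S" "(\<bar>a\<bar>, - \<bar>q\<bar>) \<in> S" using p' q' by (auto simp: rigid_def)
    then have "(\<bar>p\<bar>, \<bar>q\<bar>) \<in> S \<and> (\<bar>p\<bar>, - \<bar>q\<bar>) \<in> S"
      using mixed_rectangle p' q' by blast
    then show ?thesis using Neg by (fastforce simp: abs_if split: if_splits)
  qed
qed

end

section \<open>Interpolation and the Baker--Pixley argument\<close>

lemma openin_discrete_preimage:
  assumes "continuous_map X (discrete_topology U) f"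
  shows "openin X {x \<in> topspace X. P (f x)}"
proof -
  have "{x \<in> topspace X. P (f x)} = {x \<in> topspace X. f x \<in> {v \<in> U. P v}}"
    using continuous_map_funspace[OF assms] by auto
  then show ?thesis using openin_continuous_map_preimage[OF assms, of "{v \<in> U. P v}"] by simp
qed

lemma continuous_map_discreteI:
  assumes "\<And>x. x \<in> topspace X \<Longrightarrow> f x \<in> U" "\<And>v. v \<in> U \<Longrightarrow> openin X {x \<in> topspace X. f x = v}"
  shows "continuous_map X (discrete_topology U) f"
proof -
  have "openin X {x \<in> topspace X. f x \<in> V}" if "V \<subseteq> U" for V
  proof -
    have "{x \<in> topspace X. f x \<in> V} = (\<Union>v\<in>V. {x \<in> topspace X. f x = v})" by blast
    moreover have "openin X (\<Union>v\<in>V. {x \<in> topspace X. f x = v})"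
      using assms(2) that by (intro openin_Union) auto
    ultimately show ?thesis by simp
  qed
  then show ?thesis using assms(1) by (auto simp: continuous_map_def)
qed

lemma continuous_map_discrete_Pair:
  assumes "continuous_map X (discrete_topology U) f" "continuous_map X (discrete_topology V) g"
  shows "continuous_map X (discrete_topology (U \<times> V)) (\<lambda>x. (f x, g x))"
proof (rule continuous_map_discreteI)
  show "(f x, g x) \<in> U \<times> V" if "x \<in> topspace X" for x
    using that assms[THEN continuous_map_funspace] by auto
  show "openin X {x \<in> topspace X. (f x, g x) = v}" for v
  proof -
    have "{x \<in> topspace X. (f x, g x) = v} =
        {x \<in> topspace X. f x = fst v} \<inter> {x \<in> topspace X. g x = snd v}"
      by (auto simp: prod_eq_iff)
    then show ?thesis
      using openin_Int[OF openin_discrete_preimage[OF assms(1), of "\<lambda>a. a = fst v"]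
          openin_discrete_preimage[OF assms(2), of "\<lambda>a. a = snd v"]] by simp
  qed
qed

lemma continuous_map_discrete_comp:
  assumes "continuous_map X (discrete_topology U) f" "\<And>v. v \<in> U \<Longrightarrow> q v \<in> V"
  shows "continuous_map X (discrete_topology V) (\<lambda>x. q (f x))"
  using continuous_map_compose[OF assms(1), of "discrete_topology V" q] assms(2) by (simp add: comp_def)

lemma Z_even_simps [simp]:
  "universe (Z_even n) = Z_even_universe n" "oper (Z_even n) = Z_oper"
  by (auto simp: Z_even_def Z_algebra_def subalgebra_on_def)

lemma power_subuniverseD:
  assumes "subuniverse sugihara_signature (power_algebra (Z_even n) I) T"
    and "sugihara_signature s = Some k" "length ts = k" "set ts \<subseteq> T"
  shows "(\<lambda>x\<in>I. Z_oper s (map (\<lambda>t. t x) ts)) \<in> T"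
proof -
  have "ts \<in> tuples T k" using assms(3,4) by (simp add: tuples_def)
  then have "oper (power_algebra (Z_even n) I) s ts \<in> T"
    using assms(1,2) unfolding subuniverse_def by blast
  then show ?thesis by (simp add: power_algebra_def)
qed

lemma power_subuniverse_ops:
  assumes "subuniverse sugihara_signature (power_algebra (Z_even n) I) T" "s \<in> T" "t \<in> T"
  shows "(\<lambda>x\<in>I. - s x) \<in> T" "(\<lambda>x\<in>I. min (s x) (t x)) \<in> T" "(\<lambda>x\<in>I. max (s x) (t x)) \<in> T"
    "(\<lambda>x\<in>I. Z_oper Imp [s x, t x]) \<in> T"
  using power_subuniverseD[OF assms(1), of Neg 1 "[s]"] power_subuniverseD[OF assms(1), of Meet 2 "[s, t]"]
    power_subuniverseD[OF assms(1), of Join 2 "[s, t]"] power_subuniverseD[OF assms(1), of Imp 2 "[s, t]"]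
    assms(2,3)
  by auto

lemma binary_image:
  assumes "subuniverse sugihara_signature (power_algebra (Z_even n) (points X)) T"
    and "T \<subseteq> ego_hom n X" "x \<in> points X" "y \<in> points X"
  shows "binary_subuniverse n ((\<lambda>t. (t x, t y)) ` T)"
proof
  note ops = power_subuniverse_ops[OF assms(1)]
  fix a b assume ab: "(a, b) \<in> (\<lambda>t. (t x, t y)) ` T"
  then obtain s where s: "s \<in> T" "a = s x" "b = s y" by auto
  show "a \<in> Z_even_universe n \<and> b \<in> Z_even_universe n"
    using s assms(2-) by (auto intro: ego_hom_val)
  show "(- a, - b) \<in> (\<lambda>t. (t x, t y)) ` T"
    by (rule image_eqI[OF _ ops(1)[OF s(1) s(1)]]) (use s assms(3,4) in simp)
  fix c d assume "(c, d) \<in> (\<lambda>t. (t x, t y)) ` T"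
  then obtain t where t: "t \<in> T" "c = t x" "d = t y" by auto
  show "(min a c, min b d) \<in> (\<lambda>t. (t x, t y)) ` T"
    by (rule image_eqI[OF _ ops(2)[OF s(1) t(1)]]) (use s t assms(3,4) in simp)
  show "(max a c, max b d) \<in> (\<lambda>t. (t x, t y)) ` T"
    by (rule image_eqI[OF _ ops(3)[OF s(1) t(1)]]) (use s t assms(3,4) in simp)
  show "(if a \<le> c then max (- a) c else min (- a) c, if b \<le> d then max (- b) d else min (- b) d)
      \<in> (\<lambda>t. (t x, t y)) ` T"
    by (rule image_eqI[OF _ ops(4)[OF s(1) t(1)]]) (use s t assms(3,4) in simp)
qed

text \<open>Let \<open>S\<close> be the set of joint values of \<open>T\<close> at x and y. Moving x
  and y by the two lifts turns membership in \<open>S\<close> into a congruence between the new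
  points x' and y'. It holds for all of \<open>T\<close>, so it is a fact about \<open>X\<close>,
  and u must respect it.\<close>

lemma determines_interpolation:
  assumes T: "determines n T X" "subuniverse sugihara_signature (power_algebra (Z_even n) (points X)) T"
    and x: "x \<in> points X" and y: "y \<in> points X" and u: "u \<in> ego_hom n X"
  obtains t where "t \<in> T" "t x = u x" "t y = u y"
proof -
  define S where "S = (\<lambda>t. (t x, t y)) ` T"
  have TH: "T \<subseteq> ego_hom n X" using T(1) by (simp add: determines_def)
  interpret S: binary_subuniverse n S unfolding S_def by (rule binary_image[OF T(2) TH x y])
  interpret C: binary_subuniverse n "prod.swap ` S" by (rule S.converse_binary_subuniverse)
  have mem: "(t x, t y) \<in> S" if "t \<in> T" for t using that by (auto simp: S_def)
  define P where "P = {a \<in> fst ` S. 0 < a}"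
  define Q where "Q = {a \<in> fst ` prod.swap ` S. 0 < a}"
  have abs: "(\<bar>t x\<bar>, \<bar>t y\<bar>) \<in> S" "0 < \<bar>t x\<bar>" "0 < \<bar>t y\<bar>" if "t \<in> T" for t
    using S.abs_mem[OF mem[OF that]] S.nonzero[OF mem[OF that]] by auto
  have "\<exists>x'\<in>points X. \<forall>u\<in>ego_hom n X. \<bar>u x\<bar> \<in> P \<and> u x' = odd_ext S.lift1 (u x)"
  proof (rule push[OF T(1) x])
    show "P \<subseteq> {1..int n}" using S.universe by (force simp: P_def Z_even_universe_def)
    show "\<bar>t x\<bar> \<in> P" if "t \<in> T" for t using abs[OF that] by (force simp: P_def)
    show "strict_mono_on P S.lift1" unfolding P_def by (rule S.lift1_strict_mono)
    show "S.lift1 ` P \<subseteq> {1..int n}" using S.lift1_range unfolding P_def by blast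
  qed
  then obtain x' where x': "x' \<in> points X"
    "\<And>u. u \<in> ego_hom n X \<Longrightarrow> \<bar>u x\<bar> \<in> P \<and> u x' = odd_ext S.lift1 (u x)" by blast
  have "\<exists>y'\<in>points X. \<forall>u\<in>ego_hom n X. \<bar>u y\<bar> \<in> Q \<and> u y' = odd_ext S.lift2 (u y)"
  proof (rule push[OF T(1) y])
    show "Q \<subseteq> {1..int n}" using C.universe by (force simp: Q_def Z_even_universe_def)
    show "\<bar>t y\<bar> \<in> Q" if "t \<in> T" for t using abs[OF that] by (force simp: Q_def)
    show "strict_mono_on Q S.lift2" unfolding Q_def S.lift1_converse[symmetric] by (rule C.lift1_strict_mono)
    show "S.lift2 ` Q \<subseteq> {1..int n}"
      using C.lift1_range unfolding S.lift1_converse Q_def by blast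
  qed
  then obtain y' where y': "y' \<in> points X"
    "\<And>u. u \<in> ego_hom n X \<Longrightarrow> \<bar>u y\<bar> \<in> Q \<and> u y' = odd_ext S.lift2 (u y)" by blast
  define m where "m = n - card S.rigid"
  have app: "approx m (t x') (t y')" if "t \<in> T" for t
    using S.approx_lift[OF mem[OF that]] x'(2) y'(2) TH that by (auto simp: m_def)
  have "approx m (u x') (u y')"
  proof -
    \<comment> \<open>The extremes have no relation symbol: separation of points takes care of
      equality, and the range of values makes the full relation trivial.\<close>
    consider "m = 0" | "m = n" | "1 \<le> m" "m \<le> n - 1" by (fastforce simp: m_def)
    then show ?thesis
    proof cases
      case 1
      have "t x' = t y'" if "t \<in> T" for t using app[OF that] 1 by (auto simp: approx_def)
      then have "x' = y'" by (rule determines_separates[OF T(1) x'(1) y'(1)])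
      then show ?thesis by (simp add: approx_def)
    next
      case 2
      then show ?thesis using ego_hom_val[OF u x'(1)] ego_hom_val[OF u y'(1)]
        by (auto simp: approx_def Z_even_universe_def)
    next
      case 3
      show ?thesis
        by (rule ego_hom_approx[OF u 3 x'(1) y'(1) determines_approx[OF T(1) 3 x'(1) y'(1) app]])
    qed
  qed
  then have A: "approx m (odd_ext S.lift1 (u x)) (odd_ext S.lift2 (u y))"
    using x'(2)[OF u] y'(2)[OF u] by simp
  \<comment> \<open>u x and u y must still be shown to lie in the projections of \<open>S\<close>:
    \<open>push\<close> provides their absolute values, negation their signs.\<close>
  obtain b where "(\<bar>u x\<bar>, b) \<in> S" using x'(2)[OF u] by (auto simp: P_def)
  then have "(u x, b) \<in> S \<or> (u x, - b) \<in> S" using S.Neg[of "\<bar>u x\<bar>" b] by (auto simp: abs_if split: if_splits)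
  moreover obtain a where "(a, \<bar>u y\<bar>) \<in> S" using y'(2)[OF u] by (auto simp: Q_def)
  then have "(a, u y) \<in> S \<or> (- a, u y) \<in> S" using S.Neg[of a "\<bar>u y\<bar>"] by (auto simp: abs_if split: if_splits)
  ultimately have "(u x, u y) \<in> S" using S.mem_of_approx_lift A unfolding m_def by blast
  then show ?thesis using that by (auto simp: S_def)
qed

text \<open>The witness is the median
  \<open>(r \<and> s) \<or> (r \<and> t) \<or> (s \<and> t)\<close>, a majority operation on every
  chain.\<close>

lemma power_subuniverse_majority:
  assumes "subuniverse sugihara_signature (power_algebra (Z_even n) I) T" "r \<in> T" "s \<in> T" "t \<in> T"
  shows "\<exists>q\<in>T. \<forall>x\<in>I. \<forall>c.
    (r x = c \<and> s x = c) \<or> (r x = c \<and> t x = c) \<or> (s x = c \<and> t x = c) \<longrightarrow> q x = c"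
proof -
  define f where "f = (\<lambda>x\<in>I. min (r x) (s x))"
  define g where "g = (\<lambda>x\<in>I. max (min (r x) (t x)) (min (s x) (t x)))"
  have "(\<lambda>x\<in>I. min (r x) (t x)) \<in> T" "(\<lambda>x\<in>I. min (s x) (t x)) \<in> T" "f \<in> T"
    using power_subuniverse_ops(2)[OF assms(1)] assms(2-) by (auto simp: f_def)
  moreover have "(\<lambda>x\<in>I. max ((\<lambda>x\<in>I. min (r x) (t x)) x) ((\<lambda>x\<in>I. min (s x) (t x)) x)) = g"
    unfolding g_def by (rule restrict_ext) simp
  ultimately have "g \<in> T" using power_subuniverse_ops(3)[OF assms(1)] by metis
  then have "(\<lambda>x\<in>I. max (f x) (g x)) \<in> T" using \<open>f \<in> T\<close> by (intro power_subuniverse_ops(3)[OF assms(1)])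
  then show ?thesis
    by (rule bexI[rotated]) (auto simp: f_def g_def min_def max_def)
qed

text \<open>The case split of the Baker--Pixley induction: interpolation settles up to two elements,
  and removing each of three distinct elements gives three smaller sets.\<close>

lemma set_at_most_two_cases:
  obtains "W = {}" | a b where "W = {a, b}"
    | a b c where "{a, b, c} \<subseteq> W" "a \<noteq> b" "a \<noteq> c" "b \<noteq> c"
proof (cases "W = {}")
  case False
  then obtain a where a: "a \<in> W" by auto
  show ?thesis
  proof (cases "W = {a}")
    case True
    then show ?thesis using that(2)[of a a] by simp
  next
    case False
    then obtain b where b: "b \<in> W" "a \<noteq> b" using a by auto
    show ?thesis
    proof (cases "W = {a, b}")
      case True
      then show ?thesis by (rule that(2))
    next
      case False
      then obtain c where "c \<in> W" "a \<noteq> c" "b \<noteq> c" using a b by auto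
      then show ?thesis using that(3)[of a b c] a b by simp
    qed
  qed
qed (use that(1) in simp)

text \<open>The Baker--Pixley argument, with the points of the compact space grouped into the finitely many
  classes that the members of a finite subcover do not distinguish.\<close>

theorem determines_generates:
  assumes "compact_space (topo X)" "determines n T X" "T \<noteq> {}"
    and sub: "subuniverse sugihara_signature (power_algebra (Z_even n) (points X)) T"
  shows "T = ego_hom n X"
proof
  show TH: "T \<subseteq> ego_hom n X" using assms(2) by (simp add: determines_def)
  show "ego_hom n X \<subseteq> T"
  proof
    fix u assume u: "u \<in> ego_hom n X"
    \<comment> \<open>Interpolation at two points says that the open squares
      \<open>E t \<times> E t\<close> cover the compact product of X with itself.\<close>
    define E where "E = (\<lambda>t. {x \<in> points X. t x = u x})"
    have openE: "openin (topo X) (E t)" if "t \<in> T" for t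
    proof -
      have "t \<in> ego_hom n X" using that TH by blast
      from openin_discrete_preimage[OF continuous_map_discrete_Pair[OF
          ego_hom_continuous[OF this] ego_hom_continuous[OF u]], of "\<lambda>(a, b). a = b"]
      show ?thesis by (simp add: E_def)
    qed
    have compact: "compact_space (prod_topology (topo X) (topo X))"
      using assms(1) by (simp add: compact_space_prod_topology)
    have opn: "\<forall>U\<in>(\<lambda>t. E t \<times> E t) ` T. openin (prod_topology (topo X) (topo X)) U"
      using openE by (auto simp: openin_prod_Times_iff)
    have cover: "topspace (prod_topology (topo X) (topo X)) \<subseteq> \<Union>((\<lambda>t. E t \<times> E t) ` T)"
    proof
      fix p assume "p \<in> topspace (prod_topology (topo X) (topo X))"
      then obtain x y where p: "p = (x, y)" "x \<in> points X" "y \<in> points X" by auto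
      obtain t where "t \<in> T" "t x = u x" "t y = u y"
        by (rule determines_interpolation[OF assms(2) sub p(2,3) u])
      then show "p \<in> \<Union>((\<lambda>t. E t \<times> E t) ` T)" using p by (auto simp: E_def)
    qed
    have "\<exists>\<F>. finite \<F> \<and> \<F> \<subseteq> (\<lambda>t. E t \<times> E t) ` T \<and>
        topspace (prod_topology (topo X) (topo X)) \<subseteq> \<Union>\<F>"
      using compact[unfolded compact_space_alt, THEN spec, of "(\<lambda>t. E t \<times> E t) ` T", THEN mp, OF conjI]
        opn cover by (simp only:)
    then obtain \<F> where \<F>: "finite \<F>" "\<F> \<subseteq> (\<lambda>t. E t \<times> E t) ` T"
        "topspace (prod_topology (topo X) (topo X)) \<subseteq> \<Union>\<F>"
      by (elim exE conjE)
    from finite_subset_image[OF \<F>(1,2)]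
    obtain F where F: "finite F" "F \<subseteq> T" "\<F> = (\<lambda>t. E t \<times> E t) ` F"
      by (elim exE conjE)
    then have FE: "points X \<times> points X \<subseteq> (\<Union>t\<in>F. E t \<times> E t)" using \<F>(3) by simp
    \<comment> \<open>A member of \<open>F\<close> that agrees with u at one point of a class agrees
      with it on the whole class, so finitely many classes can stand in for the points.\<close>
    define cls where "cls = (\<lambda>z. {t \<in> F. t z = u z})"
    have "finite (cls ` points X)"
      by (rule finite_subset[of _ "Pow F"]) (use F(1) in \<open>auto simp: cls_def\<close>)
    have "\<exists>t\<in>T. \<forall>z\<in>points X. cls z \<in> W \<longrightarrow> t z = u z" if "W \<subseteq> cls ` points X" for W
      using that
    proof (induction "card W" arbitrary: W rule: less_induct)
      case less
      have fin: "finite W" using less.prems \<open>finite (cls ` points X)\<close> finite_subset by blast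
      consider "W = {}" | w1 w2 where "W = {w1, w2}"
        | w1 w2 w3 where "{w1, w2, w3} \<subseteq> W" "w1 \<noteq> w2" "w1 \<noteq> w3" "w2 \<noteq> w3"
        by (rule set_at_most_two_cases)
      then show ?case
      proof cases
        case 1
        then show ?thesis using assms(3) by auto
      next
        case (2 w1 w2)
        then obtain z1 z2 where z: "z1 \<in> points X" "z2 \<in> points X" "w1 = cls z1" "w2 = cls z2"
          using less.prems by auto
        then obtain t where "t \<in> F" "z1 \<in> E t" "z2 \<in> E t" using FE by blast
        then have "t \<in> w1" "t \<in> w2" by (auto simp: z E_def cls_def)
        then have "t z = u z" if "cls z \<in> W" for z using that 2 by (auto simp: cls_def)
        then show ?thesis using \<open>t \<in> F\<close> F(2) by blast
      next
        case (3 w1 w2 w3)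
        then have W: "w1 \<in> W" "w2 \<in> W" "w3 \<in> W" by auto
        have IH: "\<exists>t\<in>T. \<forall>z\<in>points X. cls z \<in> W - {w} \<longrightarrow> t z = u z" if "w \<in> W" for w
          by (rule less.hyps) (use less.prems that card_Diff1_less[OF fin that] in auto)
        from IH[OF W(1)] obtain t1 where t1: "t1 \<in> T" "\<forall>z\<in>points X. cls z \<in> W - {w1} \<longrightarrow> t1 z = u z" by (elim bexE)
        from IH[OF W(2)] obtain t2 where t2: "t2 \<in> T" "\<forall>z\<in>points X. cls z \<in> W - {w2} \<longrightarrow> t2 z = u z" by (elim bexE)
        from IH[OF W(3)] obtain t3 where t3: "t3 \<in> T" "\<forall>z\<in>points X. cls z \<in> W - {w3} \<longrightarrow> t3 z = u z" by (elim bexE)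
        from power_subuniverse_majority[OF sub t1(1) t2(1) t3(1)]
        obtain q where q: "q \<in> T" "\<forall>x\<in>points X. \<forall>c.
            (t1 x = c \<and> t2 x = c) \<or> (t1 x = c \<and> t3 x = c) \<or> (t2 x = c \<and> t3 x = c) \<longrightarrow> q x = c"
          by (elim bexE)
        \<comment> \<open>The class of z differs from at least two of w1, w2, w3, so at least two of
          t1, t2, t3 take the value u z.\<close>
        have "q z = u z" if "z \<in> points X" "cls z \<in> W" for z
        proof (rule q(2)[rule_format, OF that(1)])
          show "(t1 z = u z \<and> t2 z = u z) \<or> (t1 z = u z \<and> t3 z = u z) \<or> (t2 z = u z \<and> t3 z = u z)"
            using that t1(2) t2(2) t3(2) 3 by (cases "cls z = w1"; cases "cls z = w2") auto
        qed
        then show ?thesis using q(1) by blast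
      qed
    qed
    from this[of "cls ` points X"]
    obtain t where t: "t \<in> T" "\<forall>z\<in>points X. t z = u z" by blast
    have "t = u"
      by (rule PiE_ext[OF ego_hom_PiE ego_hom_PiE]) (use t TH u in auto)
    then show "u \<in> T" using t(1) by simp
  qed
qed

section \<open>The alter ego\<close>

text \<open>The content is that odd strictly increasing maps commute with the operations and that
  each \<approx>-relation is a congruence; the rest translates between lists and functions on
  \<open>{..<k}\<close>.\<close>

lemma alter_ego_Z_even:
  assumes "1 \<le> n"
  shows "alter_ego sugihara_signature (ego_partial_signature n) (ego_relation_signature n)
           (Z_even n) (Z_even_ego n)"
proof -
  have power_oper: "oper (power_algebra (Z_even n) I) s xs = (\<lambda>i\<in>I. Z_oper s (map (\<lambda>x. x i) xs))"
    for I :: "nat set" and s xs by (simp add: power_algebra_def)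
  have "is_algebra sugihara_signature (Z_even n)"
  proof -
    have "1 \<in> Z_even_universe n" using assms by (simp add: Z_even_universe_def)
    then show ?thesis
      using Z_oper_in_universe by (auto simp: is_algebra_def subuniverse_def tuples_def)
  qed
  moreover have "finite (universe (Z_even n))"
    by (rule finite_subset[of _ "{- int n..int n}"]) (auto simp: Z_even_universe_def)
  moreover have "is_tstructure (ego_partial_signature n) (ego_relation_signature n) (Z_even_ego n)"
  proof -
    have "dom (ego_partial n h) \<subseteq> tuples (Z_even_universe n) k \<and> ran (ego_partial n h) \<subseteq> Z_even_universe n"
      if h: "ego_partial_signature n h = Some k" for h k
    proof -
      have "k = 1" using h by (rule ego_partial_signature_Some)
      have "xs \<in> tuples (Z_even_universe n) k \<and> b \<in> Z_even_universe n"
        if b: "ego_partial n h xs = Some b" for xs b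
      proof -
        obtain a where "xs = [a]" "a \<in> pdom n h" "b = pval h a" using b by (rule ego_partial_SomeD)
        then show ?thesis using pval_odd_mono(3)[of n h a] h \<open>k = 1\<close> pdom_subset[of n h]
          by (auto simp: tuples_1)
      qed
      then show ?thesis by (auto simp: dom_def ran_def)
    qed
    moreover have "ego_relation n r \<subseteq> tuples (Z_even_universe n) k"
      if "ego_relation_signature n r = Some k" for r k
      using that by (cases r) (auto simp: tuples_2 split: if_splits)
    ultimately show ?thesis by (auto simp: is_tstructure_def)
  qed
  moreover have "let D = as_power ` dom (poper (Z_even_ego n) h)
         in subuniverse sugihara_signature (power_algebra (Z_even n) {..<k}) D \<and>
            (\<lambda>x\<in>D. the (poper (Z_even_ego n) h (map x [0..<k])))
              \<in> alg_hom sugihara_signature (subalgebra_on (power_algebra (Z_even n) {..<k}) D) (Z_even n)"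
    if h: "ego_partial_signature n h = Some k" for h k
  proof -
    have k: "k = Suc 0" using ego_partial_signature_Some[OF h] by simp
    have h': "ego_partial_signature n h \<noteq> None" using h by simp
    define D where "D = as_power ` dom (poper (Z_even_ego n) h)"
    have single: "as_power [a] = (\<lambda>i\<in>{..<Suc 0}. a)" for a :: int
      by (auto simp: as_power_def restrict_def)
    have "dom (ego_partial n h) = (\<lambda>a. [a]) ` pdom n h"
      by (auto simp: ego_partial_unary elim!: ego_partial_SomeD)
    then have D: "D = (\<lambda>a. \<lambda>i\<in>{..<Suc 0}. a) ` pdom n h"
      by (simp add: D_def image_image single)
    have val: "x 0 \<in> pdom n h \<and> x = (\<lambda>i\<in>{..<Suc 0}. x 0)" if "x \<in> D" for x
      using that by (auto simp: D)
    have op: "Z_oper s (map (\<lambda>x. x 0) xs) \<in> pdom n h"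
        "pval h (Z_oper s (map (\<lambda>x. x 0) xs)) = Z_oper s (map (\<lambda>x. pval h (x 0)) xs)"
        "(\<lambda>i\<in>{..<Suc 0}. Z_oper s (map (\<lambda>x. x i) xs)) = (\<lambda>i\<in>{..<Suc 0}. Z_oper s (map (\<lambda>x. x 0) xs))"
      if s: "sugihara_signature s = Some j" and xs: "xs \<in> tuples D j" for s j xs
    proof -
      have l: "length (map (\<lambda>x. x 0) xs) = j" and sub: "set (map (\<lambda>x. x 0) xs) \<subseteq> pdom n h"
        using xs val by (auto simp: tuples_def)
      note om = Z_oper_odd_mono[OF s l sub pval_odd_mono(1)[OF h'] pval_odd_mono(2)[OF h']]
      show "Z_oper s (map (\<lambda>x. x 0) xs) \<in> pdom n h" by (rule om)
      show "pval h (Z_oper s (map (\<lambda>x. x 0) xs)) = Z_oper s (map (\<lambda>x. pval h (x 0)) xs)"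
        using om(2) by (simp add: comp_def)
      show "(\<lambda>i\<in>{..<Suc 0}. Z_oper s (map (\<lambda>x. x i) xs)) = (\<lambda>i\<in>{..<Suc 0}. Z_oper s (map (\<lambda>x. x 0) xs))"
        by (rule restrict_ext) simp
    qed
    have sub: "subuniverse sugihara_signature (power_algebra (Z_even n) {..<Suc 0}) D"
      unfolding subuniverse_def
    proof (intro conjI allI impI ballI)
      show "D \<subseteq> universe (power_algebra (Z_even n) {..<Suc 0})"
        using pdom_subset[of n h] by (auto simp: D power_algebra_def split: if_splits)
      show "oper (power_algebra (Z_even n) {..<Suc 0}) s xs \<in> D"
        if "sugihara_signature s = Some j" "xs \<in> tuples D j" for s j xs
        unfolding power_oper op(3)[OF that] using op(1)[OF that] by (auto simp: D)
    qed
    have eq: "(\<lambda>x\<in>D. the (ego_partial n h (map x [0..<Suc 0]))) = (\<lambda>x\<in>D. pval h (x 0))"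
      by (rule restrict_ext) (use val in \<open>auto simp: ego_partial_unary\<close>)
    have "(\<lambda>x\<in>D. pval h (x 0))
        \<in> alg_hom sugihara_signature (subalgebra_on (power_algebra (Z_even n) {..<Suc 0}) D) (Z_even n)"
    proof -
      have "(\<lambda>x\<in>D. pval h (x 0)) (oper (power_algebra (Z_even n) {..<Suc 0}) s xs) =
          Z_oper s (map (\<lambda>x\<in>D. pval h (x 0)) xs)"
        if s: "sugihara_signature s = Some j" and xs: "xs \<in> tuples D j" for s j xs
      proof -
        have "oper (power_algebra (Z_even n) {..<Suc 0}) s xs \<in> D"
          using sub s xs unfolding subuniverse_def by blast
        moreover have M: "map (\<lambda>x\<in>D. pval h (x 0)) xs = map (\<lambda>x. pval h (x 0)) xs"
          using xs by (auto simp: tuples_def)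
        ultimately show ?thesis using op(2)[OF s xs] unfolding M by (simp add: power_oper)
      qed
      then show ?thesis
        using val pval_odd_mono(3)[OF h'] by (auto simp: alg_hom_def subalgebra_on_def)
    qed
    then show ?thesis using sub eq unfolding Let_def D_def[symmetric] k by simp
  qed
  moreover have "subuniverse sugihara_signature (power_algebra (Z_even n) {..<k})
      (as_power ` rels (Z_even_ego n) r)"
    if r: "ego_relation_signature n r = Some k" for r k
  proof -
    obtain m where m: "r = Approx m" by (cases r)
    have k: "k = 2" using r m by (auto split: if_splits)
    define R where "R = as_power ` ego_relation n (Approx m)"
    have pair: "as_power [a, b] = (\<lambda>i\<in>{..<2}. if i = 0 then a else b)" for a b :: int
      by (auto simp: as_power_def restrict_def less_2_cases_iff fun_eq_iff)
    have R: "x \<in> R \<longleftrightarrow> (\<exists>a\<in>Z_even_universe n. \<exists>b\<in>Z_even_universe n. approx m a b \<and>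
        x = (\<lambda>i\<in>{..<2}. if i = 0 then a else b))" for x
      by (auto simp: R_def pair[symmetric])
    have "oper (power_algebra (Z_even n) {..<2}) s xs \<in> R"
      if s: "sugihara_signature s = Some j" and xs: "xs \<in> tuples R j" for s j xs
    proof -
      define a where "a = Z_oper s (map (\<lambda>x. x 0) xs)"
      define b where "b = Z_oper s (map (\<lambda>x. x 1) xs)"
      have mem: "x 0 \<in> Z_even_universe n" "x 1 \<in> Z_even_universe n" "approx m (x 0) (x 1)" if "x \<in> R" for x
        using that by (auto simp: R)
      have "a \<in> Z_even_universe n" "b \<in> Z_even_universe n"
        unfolding a_def b_def
        by (rule Z_oper_in_universe[OF s]; use xs mem in \<open>force simp: tuples_def\<close>)+
      moreover have "approx m a b"
        unfolding a_def b_def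
        by (rule Z_oper_approx[OF s]) (use xs mem in \<open>auto simp: tuples_def subset_iff\<close>)
      moreover have "(\<lambda>i\<in>{..<2::nat}. Z_oper s (map (\<lambda>x. x i) xs)) = (\<lambda>i\<in>{..<2}. if i = 0 then a else b)"
        by (rule restrict_ext) (auto simp: a_def b_def less_2_cases_iff)
      ultimately show ?thesis unfolding R power_oper by blast
    qed
    moreover have "R \<subseteq> universe (power_algebra (Z_even n) {..<2})"
      by (auto simp: R power_algebra_def split: if_splits)
    ultimately show ?thesis unfolding k m R_def by (simp add: subuniverse_def)
  qed
  ultimately show ?thesis by (simp add: alter_ego_def)
qed

lemma alg_hom_oper:
  assumes "x \<in> alg_hom sugihara_signature A (Z_even n)" "sugihara_signature s = Some k"
    "xs \<in> tuples (universe A) k"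
  shows "x (oper A s xs) = Z_oper s (map x xs)"
  using assms by (auto simp: alg_hom_def)

lemma continuous_map_Z_oper:
  assumes "sugihara_signature s = Some k" "length fs = k"
    and "\<And>f. f \<in> set fs \<Longrightarrow> continuous_map X (discrete_topology (Z_even_universe n)) f"
  shows "continuous_map X (discrete_topology (Z_even_universe n)) (\<lambda>x. Z_oper s (map (\<lambda>f. f x) fs))"
  using assms(1,2)
proof (cases rule: sugihara_signature_arity)
  case (1 f)
  have "continuous_map X (discrete_topology (Z_even_universe n)) (\<lambda>x. Z_oper s [f x])"
  proof (rule continuous_map_discrete_comp[where f = f])
    show "Z_oper s [v] \<in> Z_even_universe n" if "v \<in> Z_even_universe n" for v
      using that Z_oper_in_universe[OF assms(1), of "[v]"] 1 by auto
  qed (use assms(3) 1 in auto)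
  then show ?thesis using 1 by simp
next
  case (2 f g)
  have "continuous_map X (discrete_topology (Z_even_universe n))
      (\<lambda>x. (\<lambda>(a, b). Z_oper s [a, b]) (f x, g x))"
  proof (rule continuous_map_discrete_comp[OF continuous_map_discrete_Pair])
    show "(case v of (a, b) \<Rightarrow> Z_oper s [a, b]) \<in> Z_even_universe n"
      if "v \<in> Z_even_universe n \<times> Z_even_universe n" for v
      using that Z_oper_in_universe[OF assms(1), of "[fst v, snd v]"] 2 by auto
  qed (use assms(3) 2 in auto)
  then show ?thesis using 2 by simp
qed

lemma is_tstructure_poper:
  assumes "is_tstructure (ego_partial_signature n) \<rho> X" "ego_partial_signature n h \<noteq> None"
    "poper X h xs = Some y"
  shows "y \<in> points X"
proof -
  obtain k where "ego_partial_signature n h = Some k" using assms(2) by auto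
  then have "ran (poper X h) \<subseteq> points X" using assms(1) unfolding is_tstructure_def by blast
  then show ?thesis using assms(3) by (auto simp: ran_def)
qed

text \<open>The operations of the algebra commute with the partial operations, preserve the
  relations and are continuous, so applying them pointwise keeps homomorphisms.\<close>

lemma ego_hom_subuniverse:
  assumes "is_tstructure (ego_partial_signature n) (ego_relation_signature n) X"
  shows "subuniverse sugihara_signature (power_algebra (Z_even n) (points X)) (ego_hom n X)"
  unfolding subuniverse_def
proof (intro conjI allI impI ballI)
  show "ego_hom n X \<subseteq> universe (power_algebra (Z_even n) (points X))"
    using ego_hom_PiE by (auto simp: power_algebra_def)
  fix s k ts assume s: "sugihara_signature s = Some k" and ts: "ts \<in> tuples (ego_hom n X) k"
  define f where "f = (\<lambda>x\<in>points X. Z_oper s (map (\<lambda>t. t x) ts))"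
  have len: "length ts = k" and mem: "\<And>t. t \<in> set ts \<Longrightarrow> t \<in> ego_hom n X"
    using ts by (auto simp: tuples_def)
  have lenx: "length (map (\<lambda>t. t x) ts) = k" for x using len by simp
  have "f \<in> ego_hom n X"
  proof (rule ego_homI)
    show "f \<in> points X \<rightarrow>\<^sub>E Z_even_universe n"
    proof -
      have "Z_oper s (map (\<lambda>t. t x) ts) \<in> Z_even_universe n" if "x \<in> points X" for x
        by (rule Z_oper_in_universe[OF s lenx]) (use ego_hom_val[OF mem that] in auto)
      then show ?thesis by (simp add: f_def)
    qed
    have "continuous_map (topo X) (discrete_topology (Z_even_universe n)) (\<lambda>x. Z_oper s (map (\<lambda>t. t x) ts))"
      using mem by (intro continuous_map_Z_oper[OF s len] ego_hom_continuous)
    then show "continuous_map (topo X) (discrete_topology (Z_even_universe n)) f"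
      by (rule continuous_map_eq) (simp add: f_def)
    show "f x \<in> pdom n h \<and> f y = pval h (f x)"
      if h: "ego_partial_signature n h \<noteq> None" and x: "x \<in> points X" and y: "poper X h [x] = Some y" for h x y
    proof -
      note t = ego_hom_poper[OF mem h x y]
      have "set (map (\<lambda>t. t x) ts) \<subseteq> pdom n h" using t(1) by auto
      note om = Z_oper_odd_mono[OF s lenx this pval_odd_mono(1)[OF h] pval_odd_mono(2)[OF h]]
      have "map (\<lambda>t. t y) ts = map (pval h) (map (\<lambda>t. t x) ts)" using t(2) by simp
      then show ?thesis using om is_tstructure_poper[OF assms h y] x by (simp only: f_def restrict_apply if_True)
    qed
    show "approx m (f x) (f y)"
      if m: "1 \<le> m" "m \<le> n - 1" and xy: "x \<in> points X" "y \<in> points X" "[x, y] \<in> rels X (Approx m)" for m x y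
    proof -
      have "approx m (Z_oper s (map (\<lambda>t. t x) ts)) (Z_oper s (map (\<lambda>t. t y) ts))"
        by (rule Z_oper_approx[OF s lenx lenx]) (use len ego_hom_approx[OF mem m xy] in simp)
      then show ?thesis using xy by (simp add: f_def)
    qed
  qed
  then show "oper (power_algebra (Z_even n) (points X)) s ts \<in> ego_hom n X"
    by (simp add: power_algebra_def f_def)
qed

section \<open>Powers, substructures and injectivity\<close>

lemma points_power_ego: "points (power_structure (Z_even_ego n) I) = I \<rightarrow>\<^sub>E Z_even_universe n"
  by (simp add: power_structure_def)

lemma poper_power_ego:
  assumes "x \<in> I \<rightarrow>\<^sub>E Z_even_universe n"
  shows "poper (power_structure (Z_even_ego n) I) h [x] =
    (if \<forall>i\<in>I. x i \<in> pdom n h then Some (\<lambda>i\<in>I. pval h (x i)) else None)"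
proof -
  have "(\<lambda>i\<in>I. the (ego_partial n h [x i])) = (\<lambda>i\<in>I. pval h (x i))" if "\<forall>i\<in>I. x i \<in> pdom n h"
    by (rule restrict_ext) (use that in \<open>simp add: ego_partial_unary\<close>)
  moreover have "(\<forall>i\<in>I. ego_partial n h [x i] \<noteq> None) \<longleftrightarrow> (\<forall>i\<in>I. x i \<in> pdom n h)"
    by (simp add: ego_partial_unary)
  ultimately show ?thesis using assms by (simp add: power_structure_def)
qed

lemma rels_power_ego:
  "[x, y] \<in> rels (power_structure (Z_even_ego n) I) (Approx m) \<longleftrightarrow>
    x \<in> I \<rightarrow>\<^sub>E Z_even_universe n \<and> y \<in> I \<rightarrow>\<^sub>E Z_even_universe n \<and> (\<forall>i\<in>I. approx m (x i) (y i))"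
  by (auto simp: power_structure_def PiE_mem)

lemma pval_in_PiE:
  assumes "ego_partial_signature n h \<noteq> None" "\<forall>i\<in>I. x i \<in> pdom n h"
  shows "(\<lambda>i\<in>I. pval h (x i)) \<in> I \<rightarrow>\<^sub>E Z_even_universe n"
  using assms pval_odd_mono(3) by (auto split: if_splits)

lemma compact_power_ego: "compact_space (topo (power_structure (Z_even_ego n) I))"
proof -
  have "finite (Z_even_universe n)"
    by (rule finite_subset[of _ "{- int n..int n}"]) (auto simp: Z_even_universe_def)
  then show ?thesis
    by (simp add: power_structure_def compact_space_product_topology compact_space_discrete_topology)
qed

lemma power_ego_determines:
  "determines n ((\<lambda>i. \<lambda>x\<in>I \<rightarrow>\<^sub>E Z_even_universe n. x i) ` I) (power_structure (Z_even_ego n) I)"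
  (is "determines n ?E ?P")
proof -
  have hom: "(\<lambda>x\<in>I \<rightarrow>\<^sub>E Z_even_universe n. x i) \<in> ego_hom n ?P" if i: "i \<in> I" for i
  proof (rule ego_homI)
    show "(\<lambda>x\<in>I \<rightarrow>\<^sub>E Z_even_universe n. x i) \<in> points ?P \<rightarrow>\<^sub>E Z_even_universe n"
      using i by (auto simp: points_power_ego)
    have "continuous_map (topo ?P) (discrete_topology (Z_even_universe n)) (\<lambda>x. x i)"
      using i by (auto simp: power_structure_def intro!: continuous_map_product_projection)
    then show "continuous_map (topo ?P) (discrete_topology (Z_even_universe n))
        (\<lambda>x\<in>I \<rightarrow>\<^sub>E Z_even_universe n. x i)"
      by (rule continuous_map_eq) (simp add: points_power_ego)
    fix x y assume x: "x \<in> points ?P"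
    show "(\<lambda>x\<in>I \<rightarrow>\<^sub>E Z_even_universe n. x i) x \<in> pdom n h \<and>
        (\<lambda>x\<in>I \<rightarrow>\<^sub>E Z_even_universe n. x i) y = pval h ((\<lambda>x\<in>I \<rightarrow>\<^sub>E Z_even_universe n. x i) x)"
      if "ego_partial_signature n h \<noteq> None" "poper ?P h [x] = Some y" for h
    proof -
      have d: "\<forall>i\<in>I. x i \<in> pdom n h" "y = (\<lambda>i\<in>I. pval h (x i))"
        using that(2) x by (auto simp: poper_power_ego points_power_ego split: if_splits)
      show ?thesis using x i d pval_in_PiE[OF that(1) d(1)] by (simp add: points_power_ego)
    qed
    assume "y \<in> points ?P"
    then show "approx m ((\<lambda>x\<in>I \<rightarrow>\<^sub>E Z_even_universe n. x i) x) ((\<lambda>x\<in>I \<rightarrow>\<^sub>E Z_even_universe n. x i) y)"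
      if "[x, y] \<in> rels ?P (Approx m)" for m
      using that x i by (simp add: rels_power_ego points_power_ego)
  qed
  show ?thesis
    unfolding determines_def points_power_ego
  proof (intro conjI ballI allI impI)
    show "?E \<subseteq> ego_hom n ?P" using hom by blast
    fix x assume x: "x \<in> I \<rightarrow>\<^sub>E Z_even_universe n"
    show "\<exists>y\<in>I \<rightarrow>\<^sub>E Z_even_universe n. poper ?P h [x] = Some y"
      if "ego_partial_signature n h \<noteq> None" "\<forall>t\<in>?E. t x \<in> pdom n h" for h
    proof -
      have "\<forall>i\<in>I. x i \<in> pdom n h" using that(2) x by simp
      then show ?thesis using pval_in_PiE[OF that(1), of I x] x by (simp add: poper_power_ego)
    qed
    fix y assume y: "y \<in> I \<rightarrow>\<^sub>E Z_even_universe n"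
    show "x = y" if "\<forall>t\<in>?E. t x = t y"
      by (rule PiE_ext[OF x y]) (use that x y in simp)
    show "[x, y] \<in> rels ?P (Approx m)" if "\<forall>t\<in>?E. approx m (t x) (t y)" for m
      using that x y by (simp add: rels_power_ego)
  qed
qed

lemma substructure_on_simps [simp]:
  "topo (substructure_on Y S) = subtopology (topo Y) S"
  "poper (substructure_on Y S) h xs = (if set xs \<subseteq> S then poper Y h xs else None)"
  "rels (substructure_on Y S) r = {xs \<in> rels Y r. set xs \<subseteq> S}"
  by (simp_all add: substructure_on_def)

context
  fixes n X Y S \<phi>
  assumes S: "closed_substructure (ego_partial_signature n) Y S"
    and iso: "\<phi> \<in> str_iso (ego_partial_signature n) (ego_relation_signature n) X (substructure_on Y S)"
begin

lemma str_iso_inverse: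
  "\<exists>\<psi>\<in>str_hom (ego_partial_signature n) (ego_relation_signature n) (substructure_on Y S) X.
     (\<forall>x\<in>points X. \<psi> (\<phi> x) = x) \<and> (\<forall>y\<in>S. \<phi> (\<psi> y) = y)"
proof -
  have "points (substructure_on Y S) = S"
    using S closedin_subset unfolding closed_substructure_def by fastforce
  then show ?thesis using iso unfolding str_iso_def by auto
qed

lemma str_iso_hom:
  "\<phi> \<in> str_hom (ego_partial_signature n) (ego_relation_signature n) X (substructure_on Y S)"
  using iso by (simp add: str_iso_def)

lemma str_iso_mem: "x \<in> points X \<Longrightarrow> \<phi> x \<in> S \<and> \<phi> x \<in> points Y"
  using str_iso_hom by (auto simp: str_hom_def)

lemma closed_substructure_points: "points (substructure_on Y S) = S"
  using S closedin_subset unfolding closed_substructure_def by fastforce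

lemma compact_via_str_iso:
  assumes "compact_space (topo Y)"
  shows "compact_space (topo X)"
proof -
  obtain \<psi> where \<psi>: "\<psi> \<in> str_hom (ego_partial_signature n) (ego_relation_signature n) (substructure_on Y S) X"
      "\<And>x. x \<in> points X \<Longrightarrow> \<psi> (\<phi> x) = x" "\<And>y. y \<in> S \<Longrightarrow> \<phi> (\<psi> y) = y"
    using str_iso_inverse by blast
  have "compactin (topo Y) S"
    using assms S by (intro closedin_compact_space) (auto simp: closed_substructure_def)
  then have "compactin (subtopology (topo Y) S) S" by (simp add: compactin_subtopology)
  moreover have "continuous_map (subtopology (topo Y) S) (topo X) \<psi>"
    using \<psi>(1) by (simp add: str_hom_def)
  ultimately have "compactin (topo X) (\<psi> ` S)" by (rule image_compactin)
  moreover have "\<psi> ` S = points X"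
  proof
    have "\<psi> \<in> points (substructure_on Y S) \<rightarrow>\<^sub>E points X" using \<psi>(1) by (simp add: str_hom_def)
    then show "\<psi> ` S \<subseteq> points X" unfolding closed_substructure_points by auto
    show "points X \<subseteq> \<psi> ` S" using \<psi>(2) str_iso_mem by force
  qed
  ultimately show ?thesis by (simp add: compact_space_def)
qed

text \<open>Carries a determining family over to a copy of a closed substructure. Closedness matters
  for the partial operations: a value computed in \<open>Y\<close> must lie in \<open>S\<close>
  before \<psi> can pull it back.\<close>

lemma determines_via_str_iso:
  assumes E: "determines n E Y"
    and X: "\<And>h x y. ego_partial_signature n h \<noteq> None \<Longrightarrow> x \<in> points X \<Longrightarrow> poper X h [x] = Some y \<Longrightarrow>
      y \<in> points X"
  shows "determines n ((\<lambda>e. \<lambda>x\<in>points X. e (\<phi> x)) ` E) X"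
proof -
  note \<phi> = str_iso_hom
  obtain \<psi> where \<psi>: "\<psi> \<in> str_hom (ego_partial_signature n) (ego_relation_signature n) (substructure_on Y S) X"
      "\<And>x. x \<in> points X \<Longrightarrow> \<psi> (\<phi> x) = x" "\<And>y. y \<in> S \<Longrightarrow> \<phi> (\<psi> y) = y"
    using str_iso_inverse by blast
  have E_hom: "E \<subseteq> ego_hom n Y" using E by (simp add: determines_def)
  have hom: "(\<lambda>x\<in>points X. e (\<phi> x)) \<in> ego_hom n X" if "e \<in> E" for e
  proof (rule ego_homI)
    have e: "e \<in> ego_hom n Y" using that E_hom by blast
    show "(\<lambda>x\<in>points X. e (\<phi> x)) \<in> points X \<rightarrow>\<^sub>E Z_even_universe n"
      using ego_hom_val[OF e] str_iso_mem by simp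
    have "continuous_map (topo X) (topo Y) \<phi>"
      using \<phi> by (auto simp: str_hom_def continuous_map_in_subtopology)
    then have "continuous_map (topo X) (discrete_topology (Z_even_universe n)) (e \<circ> \<phi>)"
      by (rule continuous_map_compose) (rule ego_hom_continuous[OF e])
    then show "continuous_map (topo X) (discrete_topology (Z_even_universe n)) (\<lambda>x\<in>points X. e (\<phi> x))"
      by (rule continuous_map_eq) simp
    fix x y assume x: "x \<in> points X"
    show "(\<lambda>x\<in>points X. e (\<phi> x)) x \<in> pdom n h \<and>
        (\<lambda>x\<in>points X. e (\<phi> x)) y = pval h ((\<lambda>x\<in>points X. e (\<phi> x)) x)"
      if h: "ego_partial_signature n h \<noteq> None" and y: "poper X h [x] = Some y" for h
    proof -
      have "poper Y h [\<phi> x] = Some (\<phi> y)"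
        using ego_signature_hom_poper[OF \<phi> h x y] by (simp split: if_splits)
      then show ?thesis using ego_hom_poper[OF e h] str_iso_mem[OF x] x X[OF h x y] by simp
    qed
    assume y: "y \<in> points X"
    show "approx m ((\<lambda>x\<in>points X. e (\<phi> x)) x) ((\<lambda>x\<in>points X. e (\<phi> x)) y)"
      if m: "1 \<le> m" "m \<le> n - 1" and r: "[x, y] \<in> rels X (Approx m)" for m
    proof -
      have "[\<phi> x, \<phi> y] \<in> rels Y (Approx m)"
        using ego_signature_hom_rel[OF \<phi> m x y r] by simp
      then show ?thesis using ego_hom_approx[OF e m] str_iso_mem x y by simp
    qed
  qed
  show ?thesis
    unfolding determines_def
  proof (intro conjI ballI allI impI)
    show "(\<lambda>e. \<lambda>x\<in>points X. e (\<phi> x)) ` E \<subseteq> ego_hom n X" using hom by blast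
    fix x assume x: "x \<in> points X"
    show "\<exists>y\<in>points X. poper X h [x] = Some y"
      if h: "ego_partial_signature n h \<noteq> None"
        and dom: "\<forall>t\<in>(\<lambda>e. \<lambda>x\<in>points X. e (\<phi> x)) ` E. t x \<in> pdom n h" for h
    proof -
      have "e (\<phi> x) \<in> pdom n h" if "e \<in> E" for e using dom x that by auto
      then obtain y where y: "poper Y h [\<phi> x] = Some y"
        using determines_poper[OF E h] str_iso_mem[OF x] by blast
      obtain k where "ego_partial_signature n h = Some k" using h by auto
      then have "ego_partial_signature n h = Some (Suc 0)" using ego_partial_signature_Some by fastforce
      then have "\<forall>xs\<in>tuples S (Suc 0). \<forall>y. poper Y h xs = Some y \<longrightarrow> y \<in> S"
        using S unfolding closed_substructure_def by blast
      moreover have "[\<phi> x] \<in> tuples S (Suc 0)" using str_iso_mem[OF x] by (simp add: tuples_1)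
      ultimately have "y \<in> S" using y by blast
      have "poper (substructure_on Y S) h [\<phi> x] = Some y" using y str_iso_mem[OF x] by simp
      then have "poper X h [\<psi> (\<phi> x)] = Some (\<psi> y)"
        using ego_signature_hom_poper[OF \<psi>(1) h] str_iso_mem[OF x] closed_substructure_points by blast
      then have "poper X h [x] = Some (\<psi> y)" using \<psi>(2)[OF x] by simp
      then show ?thesis using X[OF h x] by blast
    qed
    fix y assume y: "y \<in> points X"
    show "x = y" if t: "\<forall>t\<in>(\<lambda>e. \<lambda>x\<in>points X. e (\<phi> x)) ` E. t x = t y"
    proof -
      have e: "e (\<phi> x) = e (\<phi> y)" if "e \<in> E" for e
        using t[THEN bspec, OF imageI[OF that]] x y by simp
      have "\<phi> x = \<phi> y"
      proof (rule determines_separates[OF E])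
        show "\<phi> x \<in> points Y" by (rule conjunct2[OF str_iso_mem[OF x]])
        show "\<phi> y \<in> points Y" by (rule conjunct2[OF str_iso_mem[OF y]])
        show "e (\<phi> x) = e (\<phi> y)" if "e \<in> E" for e by (rule e[OF that])
      qed
      then have "\<psi> (\<phi> x) = \<psi> (\<phi> y)" by (rule arg_cong)
      then show ?thesis by (simp only: \<psi>(2)[OF x] \<psi>(2)[OF y])
    qed
    show "[x, y] \<in> rels X (Approx m)" if m: "1 \<le> m" "m \<le> n - 1"
      and t: "\<forall>t\<in>(\<lambda>e. \<lambda>x\<in>points X. e (\<phi> x)) ` E. approx m (t x) (t y)" for m
    proof -
      have e: "approx m (e (\<phi> x)) (e (\<phi> y))" if "e \<in> E" for e
        using t[THEN bspec, OF imageI[OF that]] x y by simp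
      have "[\<phi> x, \<phi> y] \<in> rels Y (Approx m)"
      proof (rule determines_approx[OF E m])
        show "\<phi> x \<in> points Y" by (rule conjunct2[OF str_iso_mem[OF x]])
        show "\<phi> y \<in> points Y" by (rule conjunct2[OF str_iso_mem[OF y]])
        show "approx m (e (\<phi> x)) (e (\<phi> y))" if "e \<in> E" for e by (rule e[OF that])
      qed
      then have "[\<phi> x, \<phi> y] \<in> rels (substructure_on Y S) (Approx m)" using str_iso_mem x y by simp
      then have "[\<psi> (\<phi> x), \<psi> (\<phi> y)] \<in> rels X (Approx m)"
        using ego_signature_hom_rel[OF \<psi>(1) m] str_iso_mem x y closed_substructure_points by blast
      then show ?thesis by (simp only: \<psi>(2)[OF x] \<psi>(2)[OF y])
    qed
  qed
qed

end

lemma IScP_ego: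
  fixes X :: "(partial_symbol, relation_symbol, 'x) tstructure"
  assumes "X \<in> IScP TYPE('i) (ego_partial_signature n) (ego_relation_signature n) (Z_even_ego n)"
  shows "is_tstructure (ego_partial_signature n) (ego_relation_signature n) X"
    and "compact_space (topo X)" "determines n (ego_hom n X) X" "ego_hom n X \<noteq> {}"
proof -
  show X: "is_tstructure (ego_partial_signature n) (ego_relation_signature n) X"
    using assms by (simp add: IScP_def)
  obtain I :: "'i set" and S \<phi> where I: "I \<noteq> {}"
    and S: "closed_substructure (ego_partial_signature n) (power_structure (Z_even_ego n) I) S"
    and \<phi>: "\<phi> \<in> str_iso (ego_partial_signature n) (ego_relation_signature n) X
        (substructure_on (power_structure (Z_even_ego n) I) S)"
    using assms unfolding IScP_def by blast
  show "compact_space (topo X)" by (rule compact_via_str_iso[OF S \<phi> compact_power_ego])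
  define E where "E = (\<lambda>e. \<lambda>x\<in>points X. e (\<phi> x)) `
      (\<lambda>i. \<lambda>x\<in>I \<rightarrow>\<^sub>E Z_even_universe n. x i) ` I"
  have E: "determines n E X"
    unfolding E_def by (rule determines_via_str_iso[OF S \<phi> power_ego_determines is_tstructure_poper[OF X]])
  then have "E \<subseteq> ego_hom n X" by (simp add: determines_def)
  then show "determines n (ego_hom n X) X" using determines_mono[OF E] by blast
  \<comment> \<open>The index set is nonempty, so a projection exists even if \<open>X\<close> has
    no points.\<close>
  show "ego_hom n X \<noteq> {}" using \<open>E \<subseteq> ego_hom n X\<close> I by (auto simp: E_def)
qed

text \<open>The homomorphisms that extend along the embedding form a nonempty subalgebra determining
  \<open>X\<close>; by \<open>determines_generates\<close> these are all of them.\<close>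

theorem ego_injective:
  "injective_in_IScP TYPE('i) TYPE('x) TYPE('y)
     (ego_partial_signature n) (ego_relation_signature n) (Z_even_ego n)"
  unfolding injective_in_IScP_def
proof (intro allI impI ballI)
  fix X :: "(partial_symbol, relation_symbol, 'x) tstructure"
    and Y :: "(partial_symbol, relation_symbol, 'y) tstructure" and \<phi> u
  assume "X \<in> IScP TYPE('i) (ego_partial_signature n) (ego_relation_signature n) (Z_even_ego n)"
    and "Y \<in> IScP TYPE('i) (ego_partial_signature n) (ego_relation_signature n) (Z_even_ego n)"
  note X = IScP_ego[OF this(1)] and Y = IScP_ego[OF this(2)]
  assume "\<phi> \<in> str_embedding (ego_partial_signature n) (ego_relation_signature n) X Y"
  then have S: "closed_substructure (ego_partial_signature n) Y (\<phi> ` points X)"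
    and iso: "\<phi> \<in> str_iso (ego_partial_signature n) (ego_relation_signature n) X
        (substructure_on Y (\<phi> ` points X))"
    by (auto simp: str_embedding_def)
  assume u: "u \<in> ego_hom n X"
  define T where "T = (\<lambda>v. \<lambda>x\<in>points X. v (\<phi> x)) ` ego_hom n Y"
  have D: "determines n T X"
    unfolding T_def by (rule determines_via_str_iso[OF S iso Y(3) is_tstructure_poper[OF X(1)]])
  have sub: "subuniverse sugihara_signature (power_algebra (Z_even n) (points X)) T"
    unfolding subuniverse_def
  proof (intro conjI allI impI ballI)
    show "T \<subseteq> universe (power_algebra (Z_even n) (points X))"
      using D ego_hom_PiE by (fastforce simp: determines_def power_algebra_def)
    fix s k ts assume s: "sugihara_signature s = Some k" and ts: "ts \<in> tuples T k"
    then have "ts \<in> lists T" by (auto simp: tuples_def)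
    then obtain vs where vs: "ts = map (\<lambda>v. \<lambda>x\<in>points X. v (\<phi> x)) vs" "set vs \<subseteq> ego_hom n Y"
      unfolding T_def lists_image by auto
    have mem: "(\<lambda>y\<in>points Y. Z_oper s (map (\<lambda>v. v y) vs)) \<in> ego_hom n Y"
      by (rule power_subuniverseD[OF ego_hom_subuniverse[OF Y(1)] s _ vs(2)])
        (use ts vs(1) in \<open>auto simp: tuples_def\<close>)
    have eq: "oper (power_algebra (Z_even n) (points X)) s ts =
        (\<lambda>x\<in>points X. (\<lambda>y\<in>points Y. Z_oper s (map (\<lambda>v. v y) vs)) (\<phi> x))"
      unfolding power_algebra_def vs(1)
      by (auto simp: comp_def str_iso_mem[OF S iso] cong: map_cong intro!: restrict_ext)
    show "oper (power_algebra (Z_even n) (points X)) s ts \<in> T"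
      unfolding eq T_def by (rule imageI[OF mem, where f = "\<lambda>v. \<lambda>x\<in>points X. v (\<phi> x)"])
  qed
  have "T = ego_hom n X"
    by (rule determines_generates[OF X(2) D _ sub]) (use Y(4) in \<open>simp add: T_def\<close>)
  then have "u \<in> T" using u by simp
  then obtain v where v: "v \<in> ego_hom n Y" "u = (\<lambda>x\<in>points X. v (\<phi> x))"
    unfolding T_def by (rule imageE) blast
  have "v (\<phi> x) = u x" if "x \<in> points X" for x using that by (simp add: v(2))
  then show "\<exists>v\<in>ego_hom n Y. \<forall>x\<in>points X. v (\<phi> x) = u x" using v(1) by blast
qed

section \<open>Duality\<close>

lemma alg_hom_mem:
  "x \<in> alg_hom sugihara_signature A (Z_even n) \<Longrightarrow> x \<in> universe A \<rightarrow>\<^sub>E Z_even_universe n"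
  by (simp add: alg_hom_def)

lemma alg_hom_val:
  "x \<in> alg_hom sugihara_signature A (Z_even n) \<Longrightarrow> a \<in> universe A \<Longrightarrow> x a \<in> Z_even_universe n"
  using alg_hom_mem by fastforce

lemma is_algebra_oper:
  "is_algebra sugihara_signature A \<Longrightarrow> sugihara_signature s = Some k \<Longrightarrow> xs \<in> tuples (universe A) k \<Longrightarrow>
     oper A s xs \<in> universe A"
  unfolding is_algebra_def subuniverse_def by blast

lemma alg_hom_compose_pval:
  assumes "is_algebra sugihara_signature A" "x \<in> alg_hom sugihara_signature A (Z_even n)"
    and h: "ego_partial_signature n h \<noteq> None" and dom: "\<forall>a\<in>universe A. x a \<in> pdom n h"
  shows "(\<lambda>a\<in>universe A. pval h (x a)) \<in> alg_hom sugihara_signature A (Z_even n)"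
proof -
  have "(\<lambda>a\<in>universe A. pval h (x a)) (oper A s xs) = Z_oper s (map (\<lambda>a\<in>universe A. pval h (x a)) xs)"
    if s: "sugihara_signature s = Some k" and xs: "xs \<in> tuples (universe A) k" for s k xs
  proof -
    have len: "length (map x xs) = k" and sub: "set (map x xs) \<subseteq> pdom n h" and U: "set xs \<subseteq> universe A"
      using xs dom by (auto simp: tuples_def)
    have M: "map (\<lambda>a\<in>universe A. pval h (x a)) xs = map (pval h) (map x xs)" using U by auto
    have "oper A s xs \<in> universe A" by (rule is_algebra_oper[OF assms(1) s xs])
    then show ?thesis
      unfolding M using Z_oper_odd_mono(2)[OF s len sub pval_odd_mono(1)[OF h] pval_odd_mono(2)[OF h]]
        alg_hom_oper[OF assms(2) s xs] by simp
  qed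
  then show ?thesis using pval_in_PiE[OF h dom] by (simp add: alg_hom_def)
qed

text \<open>Each homomorphism equation compares two continuous maps into a discrete space, so the
  hom-set is an intersection of closed sets.\<close>

lemma closedin_alg_hom:
  assumes "is_algebra sugihara_signature A"
  shows "closedin (topo (power_structure (Z_even_ego n) (universe A))) (alg_hom sugihara_signature A (Z_even n))"
    (is "closedin ?P ?H")
proof -
  define C where "C = (\<lambda>(s, xs). {x \<in> topspace ?P. x (oper A s xs) = Z_oper s (map x xs)})"
  define J where "J = {(s, xs). \<exists>k. sugihara_signature s = Some k \<and> xs \<in> tuples (universe A) k}"
  have proj: "continuous_map ?P (discrete_topology (Z_even_universe n)) (\<lambda>x. x a)" if "a \<in> universe A" for a
    using that by (auto simp: power_structure_def intro!: continuous_map_product_projection)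
  have "closedin ?P (C p)" if "p \<in> J" for p
  proof -
    obtain s xs k where p: "p = (s, xs)" "sugihara_signature s = Some k" "xs \<in> tuples (universe A) k"
      using \<open>p \<in> J\<close> by (auto simp: J_def)
    have U: "set xs \<subseteq> universe A" "length xs = k" using p(3) by (auto simp: tuples_def)
    have "continuous_map ?P (discrete_topology (Z_even_universe n))
        (\<lambda>x. Z_oper s (map (\<lambda>f. f x) (map (\<lambda>a x. x a) xs)))"
      by (rule continuous_map_Z_oper[OF p(2)]) (use U proj in auto)
    then have c: "continuous_map ?P (discrete_topology (Z_even_universe n)) (\<lambda>x. Z_oper s (map x xs))"
      by (simp add: comp_def)
    have "oper A s xs \<in> universe A" by (rule is_algebra_oper[OF assms p(2,3)])
    note pair = continuous_map_discrete_Pair[OF proj[OF this] c]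
    have "openin ?P {x \<in> topspace ?P. x (oper A s xs) \<noteq> Z_oper s (map x xs)}"
      using openin_discrete_preimage[OF pair, of "\<lambda>(a, b). a \<noteq> b"] by simp
    moreover have "topspace ?P - C p = {x \<in> topspace ?P. x (oper A s xs) \<noteq> Z_oper s (map x xs)}"
      by (auto simp: C_def p(1))
    ultimately show ?thesis by (auto simp: closedin_def C_def p(1))
  qed
  \<comment> \<open>The inserted whole space keeps the intersected family nonempty.\<close>
  then have "closedin ?P (\<Inter>(insert (topspace ?P) (C ` J)))" by (intro closedin_Inter) auto
  moreover have "\<Inter>(insert (topspace ?P) (C ` J)) = ?H"
    unfolding alg_hom_def C_def J_def points_power_ego by auto
  ultimately show ?thesis by simp
qed

lemma closed_substructure_alg_hom:
  assumes "is_algebra sugihara_signature A"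
  shows "closed_substructure (ego_partial_signature n) (power_structure (Z_even_ego n) (universe A))
    (alg_hom sugihara_signature A (Z_even n))"
  unfolding closed_substructure_def
proof (intro conjI allI impI ballI)
  show "closedin (topo (power_structure (Z_even_ego n) (universe A))) (alg_hom sugihara_signature A (Z_even n))"
    by (rule closedin_alg_hom[OF assms])
  fix h k xs y
  assume h: "ego_partial_signature n h = Some k"
    and xs: "xs \<in> tuples (alg_hom sugihara_signature A (Z_even n)) k"
    and y: "poper (power_structure (Z_even_ego n) (universe A)) h xs = Some y"
  have "k = Suc 0" using ego_partial_signature_Some[OF h] by simp
  then obtain x where x: "xs = [x]" "x \<in> alg_hom sugihara_signature A (Z_even n)"
    using xs by (auto simp: tuples_1)
  then have "\<forall>a\<in>universe A. x a \<in> pdom n h" "y = (\<lambda>a\<in>universe A. pval h (x a))"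
    using y by (auto simp: poper_power_ego[OF alg_hom_mem] split: if_splits)
  then show "y \<in> alg_hom sugihara_signature A (Z_even n)"
    using alg_hom_compose_pval[OF assms x(2)] h by simp
qed

abbreviation dual_alg where
  "dual_alg n A \<equiv> dual_of_algebra sugihara_signature (Z_even n) (Z_even_ego n) A"

lemma points_dual_alg:
  "points (dual_alg n A) = alg_hom sugihara_signature A (Z_even n)"
  using alg_hom_mem by (auto simp: dual_of_algebra_def points_power_ego)

lemma poper_dual_alg:
  assumes "x \<in> alg_hom sugihara_signature A (Z_even n)"
  shows "poper (dual_alg n A) h [x] =
    (if \<forall>a\<in>universe A. x a \<in> pdom n h then Some (\<lambda>a\<in>universe A. pval h (x a)) else None)"
  using assms by (simp add: dual_of_algebra_def poper_power_ego[OF alg_hom_mem])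

lemma rels_dual_alg:
  assumes "x \<in> alg_hom sugihara_signature A (Z_even n)" "y \<in> alg_hom sugihara_signature A (Z_even n)"
  shows "[x, y] \<in> rels (dual_alg n A) (Approx m) \<longleftrightarrow> (\<forall>a\<in>universe A. approx m (x a) (y a))"
  using assms alg_hom_mem[OF assms(1)] alg_hom_mem[OF assms(2)]
  by (simp add: dual_of_algebra_def rels_power_ego)

text \<open>The dual is a closed substructure of a power, with the identity as isomorphism, and
  evaluations are the projections restricted to it.\<close>

lemma evaluations_determine_dual:
  assumes A: "is_algebra sugihara_signature A"
  shows "compact_space (topo (dual_alg n A))"
    and "determines n ((\<lambda>a. \<lambda>x\<in>alg_hom sugihara_signature A (Z_even n). x a) ` universe A) (dual_alg n A)"
proof -
  let ?H = "alg_hom sugihara_signature A (Z_even n)"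
  let ?P = "power_structure (Z_even_ego n) (universe A)"
  have X: "y \<in> points (dual_alg n A)"
    if "ego_partial_signature n h \<noteq> None" "x \<in> points (dual_alg n A)" "poper (dual_alg n A) h [x] = Some y"
    for h x y
    using that alg_hom_compose_pval[OF A, of x n h]
    by (auto simp: points_dual_alg poper_dual_alg split: if_splits)
  define i where "i = (\<lambda>x\<in>?H. x)"
  have "i \<in> str_hom (ego_partial_signature n) (ego_relation_signature n) (dual_alg n A) (dual_alg n A)"
  proof (rule ego_signature_homI)
    show "i \<in> points (dual_alg n A) \<rightarrow>\<^sub>E points (dual_alg n A)" by (simp add: i_def points_dual_alg)
    show "continuous_map (topo (dual_alg n A)) (topo (dual_alg n A)) i"
      by (rule continuous_map_eq[OF continuous_map_id]) (simp add: i_def points_dual_alg)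
  qed (use X in \<open>simp_all add: i_def points_dual_alg\<close>)
  then have iso: "i \<in> str_iso (ego_partial_signature n) (ego_relation_signature n) (dual_alg n A)
      (substructure_on ?P ?H)"
    unfolding dual_of_algebra_def[symmetric] str_iso_def
    by (auto simp: points_dual_alg i_def intro!: bexI[of _ i])
  note S = closed_substructure_alg_hom[OF A, of n]
  show "compact_space (topo (dual_alg n A))" by (rule compact_via_str_iso[OF S iso compact_power_ego])
  have "(\<lambda>e. \<lambda>x\<in>points (dual_alg n A). e (i x)) `
      (\<lambda>a. \<lambda>x\<in>universe A \<rightarrow>\<^sub>E Z_even_universe n. x a) ` universe A =
      (\<lambda>a. \<lambda>x\<in>?H. x a) ` universe A"
    unfolding image_image points_dual_alg
    by (intro image_cong refl restrict_ext) (simp add: i_def alg_hom_mem)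
  then show "determines n ((\<lambda>a. \<lambda>x\<in>?H. x a) ` universe A) (dual_alg n A)"
    using determines_via_str_iso[OF S iso power_ego_determines X] by simp
qed

lemma ISP_separates:
  fixes A :: "(sugihara_symbol, 'a) algebra"
  assumes "A \<in> ISP TYPE('i) sugihara_signature (Z_even n)" "a \<in> universe A" "b \<in> universe A"
    and eq: "\<And>x. x \<in> alg_hom sugihara_signature A (Z_even n) \<Longrightarrow> x a = x b"
  shows "a = b"
proof -
  have A: "is_algebra sugihara_signature A" using assms(1) by (simp add: ISP_def)
  obtain I :: "'i set" and S \<phi> where S: "subuniverse sugihara_signature (power_algebra (Z_even n) I) S"
    and \<phi>: "\<phi> \<in> alg_iso sugihara_signature A (subalgebra_on (power_algebra (Z_even n) I) S)"
    using assms(1) unfolding ISP_def by blast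
  have hom: "\<phi> \<in> universe A \<rightarrow>\<^sub>E S"
    "\<And>s k xs. sugihara_signature s = Some k \<Longrightarrow> xs \<in> tuples (universe A) k \<Longrightarrow>
       \<phi> (oper A s xs) = (\<lambda>i\<in>I. Z_oper s (map (\<lambda>x. x i) (map \<phi> xs)))"
    and inj: "inj_on \<phi> (universe A)"
    using \<phi> by (auto simp: alg_iso_def alg_hom_def subalgebra_on_def power_algebra_def bij_betw_def)
  have SP: "S \<subseteq> I \<rightarrow>\<^sub>E Z_even_universe n" using S by (simp add: subuniverse_def power_algebra_def)
  have "\<phi> a i = \<phi> b i" if i: "i \<in> I" for i
  proof -
    define x where "x = (\<lambda>a\<in>universe A. \<phi> a i)"
    have "x \<in> alg_hom sugihara_signature A (Z_even n)"
      unfolding alg_hom_def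
    proof (intro CollectI conjI allI impI ballI)
      have "\<phi> a i \<in> Z_even_universe n" if "a \<in> universe A" for a
        using hom(1) SP i that by (meson PiE_mem subsetD)
      then show "x \<in> universe A \<rightarrow>\<^sub>E universe (Z_even n)" by (simp add: x_def)
      fix s k xs assume s: "sugihara_signature s = Some k" and xs: "xs \<in> tuples (universe A) k"
      have M: "map x xs = map (\<lambda>x. x i) (map \<phi> xs)" using xs by (auto simp: x_def tuples_def)
      have "x (oper A s xs) = \<phi> (oper A s xs) i"
        using is_algebra_oper[OF A s xs] by (simp add: x_def)
      then show "x (oper A s xs) = oper (Z_even n) s (map x xs)"
        unfolding M using hom(2)[OF s xs] i by simp
    qed
    from eq[OF this] show ?thesis using assms(2,3) by (simp add: x_def)
  qed
  moreover have "\<phi> a \<in> I \<rightarrow>\<^sub>E Z_even_universe n" "\<phi> b \<in> I \<rightarrow>\<^sub>E Z_even_universe n"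
    using hom(1) SP assms(2,3) by (meson PiE_mem subsetD)+
  ultimately have "\<phi> a = \<phi> b" by (meson PiE_ext)
  then show ?thesis using inj assms(2,3) by (meson inj_onD)
qed

text \<open>The evaluations form a nonempty subalgebra that determines the dual, so they exhaust its
  homomorphisms; injectivity is separation by homomorphisms.\<close>

theorem ego_duality:
  "yields_duality TYPE('i) TYPE('a) sugihara_signature (ego_partial_signature n)
     (ego_relation_signature n) (Z_even n) (Z_even_ego n)"
  unfolding yields_duality_def
proof (intro allI impI)
  fix A :: "(sugihara_symbol, 'a) algebra"
  assume A: "A \<in> ISP TYPE('i) sugihara_signature (Z_even n)"
  then have alg: "is_algebra sugihara_signature A" by (simp add: ISP_def)
  let ?H = "alg_hom sugihara_signature A (Z_even n)"
  define ev where "ev = evaluation (universe A) ?H"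
  have ev: "ev a = (\<lambda>x\<in>?H. x a)" if "a \<in> universe A" for a
    using that by (simp add: ev_def evaluation_def)
  have oper: "ev (oper A s as) = (\<lambda>x\<in>?H. Z_oper s (map (\<lambda>t. t x) (map ev as)))"
    if s: "sugihara_signature s = Some k" and as: "as \<in> tuples (universe A) k" for s k as
  proof -
    have M: "map x as = map (\<lambda>t. t x) (map ev as)" if "x \<in> ?H" for x
      using as ev that by (auto simp: tuples_def)
    show ?thesis
      unfolding ev[OF is_algebra_oper[OF alg s as]]
    proof (rule restrict_ext)
      fix x assume x: "x \<in> ?H"
      show "x (oper A s as) = Z_oper s (map (\<lambda>t. t x) (map ev as))"
        using alg_hom_oper[OF x s as] unfolding M[OF x] .
    qed
  qed
  define T where "T = ev ` universe A"
  have T: "T = (\<lambda>a. \<lambda>x\<in>?H. x a) ` universe A" unfolding T_def by (rule image_cong) (simp_all add: ev)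
  note dual = evaluations_determine_dual[OF alg, of n, folded T]
  have sub: "subuniverse sugihara_signature (power_algebra (Z_even n) (points (dual_alg n A))) T"
    unfolding subuniverse_def
  proof (intro conjI allI impI ballI)
    show "T \<subseteq> universe (power_algebra (Z_even n) (points (dual_alg n A)))"
      using dual(2) ego_hom_PiE by (fastforce simp: determines_def power_algebra_def)
    fix s k ts assume s: "sugihara_signature s = Some k" and ts: "ts \<in> tuples T k"
    then have "ts \<in> lists T" by (auto simp: tuples_def)
    then obtain as where as: "ts = map ev as" "set as \<subseteq> universe A"
      unfolding T_def lists_image by auto
    then have as': "as \<in> tuples (universe A) k" using ts by (auto simp: tuples_def)
    have "oper (power_algebra (Z_even n) (points (dual_alg n A))) s ts = ev (oper A s as)"
      unfolding oper[OF s as'] as(1) by (simp add: power_algebra_def points_dual_alg)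
    then show "oper (power_algebra (Z_even n) (points (dual_alg n A))) s ts \<in> T"
      using is_algebra_oper[OF alg s as'] by (simp add: T_def)
  qed
  have onto: "T = ego_hom n (dual_alg n A)"
    by (rule determines_generates[OF dual _ sub]) (use alg in \<open>simp add: T_def is_algebra_def\<close>)
  have "inj_on ev (universe A)"
  proof (rule inj_onI)
    fix a b assume ab: "a \<in> universe A" "b \<in> universe A" "ev a = ev b"
    have "x a = x b" if "x \<in> ?H" for x
      using fun_cong[OF ab(3), of x] that ab(1,2) by (simp add: ev)
    then show "a = b" by (rule ISP_separates[OF A ab(1,2)])
  qed
  then have "bij_betw ev (universe A) (ego_hom n (dual_alg n A))"
    using onto by (simp add: bij_betw_def T_def)
  moreover have "ev \<in> universe A \<rightarrow>\<^sub>E ego_hom n (dual_alg n A)"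
    using onto by (auto simp: T_def ev_def evaluation_def)
  moreover have "ev (oper A s as) = oper (power_algebra (Z_even n) (points (dual_alg n A))) s (map ev as)"
    if "sugihara_signature s = Some k" "as \<in> tuples (universe A) k" for s k as
    using oper[OF that] by (simp add: power_algebra_def points_dual_alg)
  ultimately show "evaluation (universe A) ?H \<in> alg_iso sugihara_signature A
      (dual_of_structure (ego_partial_signature n) (ego_relation_signature n) (Z_even n) (Z_even_ego n)
        (dual_alg n A))"
    unfolding ev_def[symmetric] by (simp add: alg_iso_def alg_hom_def dual_of_structure_def subalgebra_on_def)
qed

section \<open>Full duality\<close>

abbreviation dual_str where
  "dual_str n X \<equiv> dual_of_structure (ego_partial_signature n) (ego_relation_signature n)
     (Z_even n) (Z_even_ego n) X"

lemma dual_str_simps [simp]: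
  "universe (dual_str n X) = ego_hom n X"
  "oper (dual_str n X) s vs = (\<lambda>x\<in>points X. Z_oper s (map (\<lambda>v. v x) vs))"
  by (simp_all add: dual_of_structure_def subalgebra_on_def power_algebra_def)

text \<open>For a = b both implications are the absolute value. For a < b the second one is
  \<open>min (- b) a\<close>, which is positive only if a is above 0 and b below it; a > b is
  symmetric.\<close>

lemma Imp_detects_eq:
  assumes "a \<noteq> 0" "b \<noteq> 0"
  shows "0 < min (Z_oper Imp [a, b]) (Z_oper Imp [b, a]) \<longleftrightarrow> a = b"
  using assms by (auto simp: min_def max_def)

lemma Z_oper_Imp_self: "Z_oper Imp [a, a] = \<bar>a\<bar>"
  by auto

context
  fixes n and X :: "(partial_symbol, relation_symbol, 'x) tstructure" and \<alpha>
  assumes X: "is_tstructure (ego_partial_signature n) (ego_relation_signature n) X"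
    and compact: "compact_space (topo X)"
    and det: "determines n (ego_hom n X) X"
    and nonempty: "ego_hom n X \<noteq> {}"
    and \<alpha>: "\<alpha> \<in> alg_hom sugihara_signature (dual_str n X) (Z_even n)"
begin

lemma hom_ops:
  assumes "u \<in> ego_hom n X" "v \<in> ego_hom n X"
  shows "\<alpha> (\<lambda>x\<in>points X. - u x) = - \<alpha> u"
    "\<alpha> (\<lambda>x\<in>points X. min (u x) (v x)) = min (\<alpha> u) (\<alpha> v)"
    "\<alpha> (\<lambda>x\<in>points X. Z_oper Imp [u x, v x]) = Z_oper Imp [\<alpha> u, \<alpha> v]"
  using alg_hom_oper[OF \<alpha>, of Neg 1 "[u]"] alg_hom_oper[OF \<alpha>, of Meet 2 "[u, v]"]
    alg_hom_oper[OF \<alpha>, of Imp 2 "[u, v]"] assms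
  by (simp_all add: tuples_def)

lemma hom_nonzero: "u \<in> ego_hom n X \<Longrightarrow> \<alpha> u \<noteq> 0"
  by (rule Z_even_universe_nonzero[OF alg_hom_val[OF \<alpha>]]) simp

lemmas closed = power_subuniverse_ops[OF ego_hom_subuniverse[OF X]]

text \<open>If u were negative everywhere, it would be the negative of
  \<open>u \<rightarrow> u\<close>, and its image under \<alpha> would be
  \<open>- \<bar>\<alpha> u\<bar>\<close>.\<close>

lemma hom_positive_somewhere:
  assumes u: "u \<in> ego_hom n X" and pos: "0 < \<alpha> u"
  shows "\<exists>x\<in>points X. 0 < u x"
proof (rule ccontr)
  assume "\<not> ?thesis"
  then have neg: "u x < 0" if "x \<in> points X" for x
    using that Z_even_universe_nonzero[OF ego_hom_val[OF u that]] by force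
  define w where "w = (\<lambda>x\<in>points X. Z_oper Imp [u x, u x])"
  have w: "w \<in> ego_hom n X" "\<alpha> w = \<bar>\<alpha> u\<bar>"
    using closed(4)[OF u u] hom_ops(3)[OF u u] unfolding Z_oper_Imp_self w_def by blast+
  have "u = (\<lambda>x\<in>points X. - w x)"
    by (rule PiE_ext[OF ego_hom_PiE[OF u] ego_hom_PiE[OF closed(1)[OF w(1) w(1)]]])
      (simp add: w_def Z_oper_Imp_self abs_of_neg[OF neg] del: Z_oper.simps)
  then have "\<alpha> u = - \<bar>\<alpha> u\<bar>" using hom_ops(1)[OF w(1) w(1)] w(2) by simp
  then show False using pos by simp
qed

text \<open>\<open>P\<close> is closed under meets and each member is positive somewhere, so the
  closed sets of positivity have the finite intersection property. A common point gives one
  direction, negation the other.\<close>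

lemma hom_sign_point: "\<exists>x\<in>points X. \<forall>u\<in>ego_hom n X. 0 < \<alpha> u \<longleftrightarrow> 0 < u x"
proof -
  define P where "P = {u \<in> ego_hom n X. 0 < \<alpha> u}"
  obtain u0 where "u0 \<in> ego_hom n X" using nonempty by blast
  then have "(\<lambda>x\<in>points X. Z_oper Imp [u0 x, u0 x]) \<in> P"
    using closed(4)[of u0 u0] hom_ops(3)[of u0 u0] hom_nonzero[of u0]
    by (simp add: P_def Z_oper_Imp_self del: Z_oper.simps)
  then have "P \<noteq> {}" by blast
  have lower: "\<exists>v\<in>P. \<forall>x\<in>points X. 0 < v x \<longrightarrow> (\<forall>u\<in>Q. 0 < u x)" if "finite Q" "Q \<subseteq> P" for Q
    using that
  proof (induction Q)
    case empty
    then show ?case using \<open>P \<noteq> {}\<close> by blast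
  next
    case (insert u Q)
    then obtain v where v: "v \<in> P" "\<forall>x\<in>points X. 0 < v x \<longrightarrow> (\<forall>u\<in>Q. 0 < u x)" by auto
    have "(\<lambda>x\<in>points X. min (u x) (v x)) \<in> P"
      using closed(2)[of u v] hom_ops(2)[of u v] v(1) insert.prems by (simp add: P_def)
    then show ?case using v(2) by (intro bexI) auto
  qed
  have "\<exists>x\<in>points X. \<forall>u\<in>P. 0 < u x"
  proof (rule ccontr)
    assume none: "\<not> ?thesis"
    define C where "C = (\<lambda>u :: 'x \<Rightarrow> int. {x \<in> points X. \<not> 0 < u x})"
    have "openin (topo X) U" if "U \<in> C ` P" for U
      using that openin_discrete_preimage[OF ego_hom_continuous] by (auto simp: C_def P_def)
    moreover have "topspace (topo X) \<subseteq> \<Union>(C ` P)" using none by (auto simp: C_def)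
    ultimately have "\<exists>\<F>. finite \<F> \<and> \<F> \<subseteq> C ` P \<and> topspace (topo X) \<subseteq> \<Union>\<F>"
      by (intro compact[unfolded compact_space_alt, THEN spec, THEN mp]) blast
    then obtain \<F> where \<F>: "finite \<F>" "\<F> \<subseteq> C ` P" "topspace (topo X) \<subseteq> \<Union>\<F>" by blast
    from finite_subset_image[OF \<F>(1,2)]
    obtain Q where Q: "finite Q" "Q \<subseteq> P" "\<F> = C ` Q" by blast
    from lower[OF Q(1,2)]
    obtain v where v: "v \<in> P" "\<forall>x\<in>points X. 0 < v x \<longrightarrow> (\<forall>u\<in>Q. 0 < u x)" by (elim bexE)
    then have "v \<in> ego_hom n X" "0 < \<alpha> v" by (simp_all only: P_def mem_Collect_eq)
    from hom_positive_somewhere[OF this] obtain x where x: "x \<in> points X" "0 < v x" by (elim bexE)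
    then obtain u where "u \<in> Q" "x \<in> C u" using \<F>(3) Q(3) by blast
    then show False using v(2) x by (auto simp: C_def)
  qed
  then obtain x where x: "x \<in> points X" "\<And>u. u \<in> P \<Longrightarrow> 0 < u x" by blast
  have "0 < \<alpha> u \<longleftrightarrow> 0 < u x" if u: "u \<in> ego_hom n X" for u
  proof
    assume "0 < u x"
    show "0 < \<alpha> u"
    proof (rule ccontr)
      assume "\<not> 0 < \<alpha> u"
      then have "(\<lambda>x\<in>points X. - u x) \<in> P"
        using closed(1)[OF u u] hom_ops(1)[OF u u] hom_nonzero[OF u] by (simp add: P_def)
      then have "0 < (\<lambda>x\<in>points X. - u x) x" by (rule x(2))
      then show False using \<open>0 < u x\<close> x(1) by simp
    qed
  qed (use x(2) u in \<open>simp add: P_def\<close>)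
  then show ?thesis using x(1) by blast
qed

text \<open>Agreement of signs makes \<alpha> and evaluation at x have the same kernel, so \<alpha>
  u is an odd strictly increasing function of u x, and \<open>push\<close> moves x to a point that
  absorbs this function.\<close>

lemma hom_is_evaluation: "\<exists>y\<in>points X. \<forall>u\<in>ego_hom n X. \<alpha> u = u y"
proof -
  obtain x where x: "x \<in> points X" and sgn: "\<And>u. u \<in> ego_hom n X \<Longrightarrow> 0 < \<alpha> u \<longleftrightarrow> 0 < u x"
    using hom_sign_point by blast
  have nz: "u x \<noteq> 0" if "u \<in> ego_hom n X" for u
    using ego_hom_val[OF that x] by (rule Z_even_universe_nonzero)
  have eq_iff: "\<alpha> u = \<alpha> v \<longleftrightarrow> u x = v x" if u: "u \<in> ego_hom n X" and v: "v \<in> ego_hom n X" for u v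
  proof -
    define f where "f = (\<lambda>x\<in>points X. Z_oper Imp [u x, v x])"
    define g where "g = (\<lambda>x\<in>points X. Z_oper Imp [v x, u x])"
    have f: "f \<in> ego_hom n X" "\<alpha> f = Z_oper Imp [\<alpha> u, \<alpha> v]" "f x = Z_oper Imp [u x, v x]"
      unfolding f_def using closed(4)[OF u v] hom_ops(3)[OF u v] x by auto
    have g: "g \<in> ego_hom n X" "\<alpha> g = Z_oper Imp [\<alpha> v, \<alpha> u]" "g x = Z_oper Imp [v x, u x]"
      unfolding g_def using closed(4)[OF v u] hom_ops(3)[OF v u] x by auto
    have "0 < min (\<alpha> f) (\<alpha> g) \<longleftrightarrow> 0 < min (f x) (g x)"
      using sgn[OF closed(2)[OF f(1) g(1)]] hom_ops(2)[OF f(1) g(1)] x by simp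
    then show ?thesis
      unfolding f(2,3) g(2,3)
      by (simp only: Imp_detects_eq hom_nonzero[OF u] hom_nonzero[OF v] nz[OF u] nz[OF v] not_False_eq_True)
  qed
  define S where "S = {u x | u. u \<in> ego_hom n X \<and> 0 < u x}"
  \<comment> \<open>The choice of u is immaterial: by \<open>eq_iff\<close>, \<alpha> u depends on u
    x only.\<close>
  define w where "w = (\<lambda>s. \<alpha> (SOME u. u \<in> ego_hom n X \<and> u x = s))"
  have w: "w (u x) = \<alpha> u" if "u \<in> ego_hom n X" for u
  proof -
    have "(SOME v. v \<in> ego_hom n X \<and> v x = u x) \<in> ego_hom n X \<and>
        (SOME v. v \<in> ego_hom n X \<and> v x = u x) x = u x"
      by (rule someI[of _ u]) (use that in simp)
    then show ?thesis using eq_iff that unfolding w_def by blast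
  qed
  have "\<exists>y\<in>points X. \<forall>u\<in>ego_hom n X. \<bar>u x\<bar> \<in> S \<and> u y = odd_ext w (u x)"
  proof (rule push[OF det x])
    show "S \<subseteq> {1..int n}" using ego_hom_val[OF _ x] by (fastforce simp: S_def Z_even_universe_def)
    show "\<bar>u x\<bar> \<in> S" if u: "u \<in> ego_hom n X" for u
    proof -
      define f where "f = (\<lambda>x\<in>points X. Z_oper Imp [u x, u x])"
      have "f \<in> ego_hom n X" unfolding f_def by (rule closed(4)[OF u u])
      moreover have "\<bar>u x\<bar> = f x" using x by (simp add: f_def)
      moreover have "0 < \<bar>u x\<bar>" using nz[OF u] by simp
      ultimately show ?thesis unfolding S_def by auto
    qed
    show "strict_mono_on S w"
    proof (rule strict_mono_onI)
      fix s t assume "s \<in> S" "t \<in> S" "s < t"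
      then obtain u v where uv: "u \<in> ego_hom n X" "v \<in> ego_hom n X" "s = u x" "t = v x" "u x < v x"
        by (auto simp: S_def)
      \<comment> \<open>m agrees with u at x, so \<alpha> gives both the same value; hence \<alpha>
        u is the smaller of \<alpha> u and \<alpha> v.\<close>
      define m where "m = (\<lambda>x\<in>points X. min (u x) (v x))"
      have "m \<in> ego_hom n X" "\<alpha> m = min (\<alpha> u) (\<alpha> v)" "m x = u x"
        unfolding m_def using closed(2)[OF uv(1,2)] hom_ops(2)[OF uv(1,2)] x uv(5) by auto
      then have "min (\<alpha> u) (\<alpha> v) = \<alpha> u" using eq_iff[of m u] uv(1) by simp
      moreover have "\<alpha> u \<noteq> \<alpha> v" using eq_iff[OF uv(1,2)] uv(5) by simp
      ultimately show "w s < w t" using w uv by simp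
    qed
    show "w ` S \<subseteq> {1..int n}"
    proof
      fix s assume "s \<in> w ` S"
      then obtain u where u: "u \<in> ego_hom n X" "0 < u x" "s = \<alpha> u" using w by (auto simp: S_def)
      then show "s \<in> {1..int n}" using sgn[OF u(1)] alg_hom_val[OF \<alpha>, of u]
        by (simp add: Z_even_universe_def)
    qed
  qed
  then obtain y where y: "y \<in> points X" "\<And>u. u \<in> ego_hom n X \<Longrightarrow> u y = odd_ext w (u x)" by blast
  have "\<alpha> u = u y" if u: "u \<in> ego_hom n X" for u
  proof (cases "0 < u x")
    case True
    then show ?thesis using y(2)[OF u] w[OF u] by (simp add: odd_ext_def)
  next
    case False
    have "w (- u x) = - \<alpha> u" using w[OF closed(1)[OF u u]] hom_ops(1)[OF u u] x by simp
    then show ?thesis using y(2)[OF u] False by (simp add: odd_ext_def)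
  qed
  then show ?thesis using y(1) by blast
qed

end

text \<open>Surjectivity is \<open>hom_is_evaluation\<close>. The inverse is continuous because the
  evaluation map is a continuous bijection from a compact space to a Hausdorff space, and it
  preserves operations and relations because \<open>X\<close> is determined by its
  homomorphisms.\<close>

theorem ego_full_duality:
  fixes X :: "(partial_symbol, relation_symbol, 'x) tstructure"
  assumes "X \<in> IScP TYPE('i) (ego_partial_signature n) (ego_relation_signature n) (Z_even_ego n)"
  shows "evaluation (points X) (ego_hom n X)
    \<in> str_iso (ego_partial_signature n) (ego_relation_signature n) X (dual_alg n (dual_str n X))"
proof -
  note X = IScP_ego[OF assms]
  let ?B = "ego_hom n X" and ?D = "dual_alg n (dual_str n X)"
  note sub = ego_hom_subuniverse[OF X(1)]
  define ev where "ev = evaluation (points X) ?B"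
  have ev: "ev x = (\<lambda>u\<in>?B. u x)" if "x \<in> points X" for x
    using that by (simp add: ev_def evaluation_def)
  have ev_hom: "ev x \<in> alg_hom sugihara_signature (dual_str n X) (Z_even n)" if x: "x \<in> points X" for x
    unfolding alg_hom_def
  proof (intro CollectI conjI allI impI ballI)
    show "ev x \<in> universe (dual_str n X) \<rightarrow>\<^sub>E universe (Z_even n)"
      using ego_hom_val[OF _ x] by (simp add: ev[OF x])
    fix s k vs assume s: "sugihara_signature s = Some k" and vs: "vs \<in> tuples (universe (dual_str n X)) k"
    then have len: "length vs = k" "set vs \<subseteq> ?B" by (auto simp: tuples_def)
    have M: "map (ev x) vs = map (\<lambda>u. u x) vs" using len by (auto simp: ev[OF x])
    show "ev x (oper (dual_str n X) s vs) = oper (Z_even n) s (map (ev x) vs)"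
      unfolding M unfolding ev[OF x] using power_subuniverseD[OF sub s len] x by simp
  qed
  have D: "points ?D = alg_hom sugihara_signature (dual_str n X) (Z_even n)" by (rule points_dual_alg)
  have poper_D: "poper ?D h [ev x] =
      (if \<forall>u\<in>?B. u x \<in> pdom n h then Some (\<lambda>u\<in>?B. pval h (u x)) else None)"
    if x: "x \<in> points X" for h x
    unfolding poper_dual_alg[OF ev_hom[OF x]] by (simp add: ev[OF x] cong: restrict_cong)
  have rels_D: "[ev x, ev y] \<in> rels ?D (Approx m) \<longleftrightarrow> (\<forall>u\<in>?B. approx m (u x) (u y))"
    if "x \<in> points X" "y \<in> points X" for m x y
    using rels_dual_alg[OF ev_hom[OF that(1)] ev_hom[OF that(2)]] that by (simp add: ev)
  have cont: "continuous_map (topo X) (topo ?D) ev"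
    unfolding dual_of_algebra_def substructure_on_simps continuous_map_in_subtopology
  proof (intro conjI)
    have "continuous_map (topo X) (discrete_topology (Z_even_universe n)) (\<lambda>x. ev x u)" if u: "u \<in> ?B" for u
      by (rule continuous_map_eq[OF ego_hom_continuous[OF u]]) (use u in \<open>simp add: ev\<close>)
    moreover have "ev ` points X \<subseteq> extensional ?B" by (auto simp: ev)
    ultimately show "continuous_map (topo X)
        (topo (power_structure (Z_even_ego n) (universe (dual_str n X)))) ev"
      by (simp add: power_structure_def continuous_map_componentwise image_subset_iff_funcset)
  qed (use ev_hom in blast)
  have inj: "inj_on ev (points X)"
  proof (rule inj_onI)
    fix x y assume xy: "x \<in> points X" "y \<in> points X" "ev x = ev y"
    show "x = y"
    proof (rule determines_separates[OF X(3) xy(1,2)])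
      show "u x = u y" if "u \<in> ?B" for u using fun_cong[OF xy(3), of u] xy(1,2) that by (simp add: ev)
    qed
  qed
  have surj: "ev ` points X = points ?D"
  proof
    show "ev ` points X \<subseteq> points ?D" using ev_hom D by blast
    show "points ?D \<subseteq> ev ` points X"
    proof
      fix \<alpha> assume "\<alpha> \<in> points ?D"
      then have \<alpha>: "\<alpha> \<in> alg_hom sugihara_signature (dual_str n X) (Z_even n)" by (simp add: D)
      obtain y where y: "y \<in> points X" "\<And>u. u \<in> ?B \<Longrightarrow> \<alpha> u = u y"
        using hom_is_evaluation[OF X \<alpha>] by blast
      have "\<alpha> = ev y"
        by (rule PiE_ext[OF alg_hom_mem[OF \<alpha>] alg_hom_mem[OF ev_hom[OF y(1)]]])
          (use y in \<open>simp add: ev\<close>)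
      then show "\<alpha> \<in> ev ` points X" using y(1) by blast
    qed
  qed
  have hom: "ev \<in> str_hom (ego_partial_signature n) (ego_relation_signature n) X ?D"
  proof (rule ego_signature_homI[OF _ cont])
    show "ev \<in> points X \<rightarrow>\<^sub>E points ?D" using surj by (auto simp: ev_def evaluation_def)
    show "poper ?D h [ev x] = Some (ev y)"
      if h: "ego_partial_signature n h \<noteq> None" and x: "x \<in> points X" and y: "poper X h [x] = Some y" for h x y
    proof -
      note u = ego_hom_poper[OF _ h x y]
      have "(\<lambda>u\<in>?B. pval h (u x)) = ev y"
        unfolding ev[OF is_tstructure_poper[OF X(1) h y]] by (rule restrict_ext) (simp add: u(2))
      then show ?thesis using u(1) by (simp add: poper_D[OF x])
    qed
    show "[ev x, ev y] \<in> rels ?D (Approx m)"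
      if "1 \<le> m" "m \<le> n - 1" "x \<in> points X" "y \<in> points X" "[x, y] \<in> rels X (Approx m)" for m x y
      using ego_hom_approx[OF _ that] by (simp add: rels_D[OF that(3,4)])
  qed
  have "Hausdorff_space (topo ?D)"
    by (simp add: dual_of_algebra_def power_structure_def Hausdorff_space_subtopology
        Hausdorff_space_product_topology)
  then have "homeomorphic_map (topo X) (topo ?D) ev"
    by (rule continuous_imp_homeomorphic_map[OF cont X(2) _ surj inj])
  then obtain g where g: "continuous_map (topo ?D) (topo X) g" "\<And>x. x \<in> points X \<Longrightarrow> g (ev x) = x"
    by (auto simp: homeomorphic_map_maps homeomorphic_maps_def)
  define \<psi> where "\<psi> = (\<lambda>\<alpha>\<in>points ?D. g \<alpha>)"
  have \<psi>: "\<psi> (ev x) = x" if "x \<in> points X" for x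
    using that g(2)[OF that] ev_hom[OF that] D by (simp add: \<psi>_def)
  have "\<psi> \<in> str_hom (ego_partial_signature n) (ego_relation_signature n) ?D X"
  proof (rule ego_signature_homI)
    show "\<psi> \<in> points ?D \<rightarrow>\<^sub>E points X"
      using continuous_map_funspace[OF g(1)] by (auto simp: \<psi>_def)
    show "continuous_map (topo ?D) (topo X) \<psi>"
      by (rule continuous_map_eq[OF g(1)]) (simp add: \<psi>_def)
    show "poper X h [\<psi> \<alpha>] = Some (\<psi> \<beta>)"
      if h: "ego_partial_signature n h \<noteq> None" and \<alpha>: "\<alpha> \<in> points ?D" and \<beta>: "poper ?D h [\<alpha>] = Some \<beta>" for h \<alpha> \<beta>
    proof -
      obtain x where x: "x \<in> points X" "\<alpha> = ev x" using \<alpha> surj by blast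
      then have dom: "\<forall>u\<in>?B. u x \<in> pdom n h" using \<beta> by (auto simp: poper_D split: if_splits)
      obtain y where y: "y \<in> points X" "poper X h [x] = Some y"
        using determines_poper[OF X(3) h x(1)] dom by blast
      have "\<beta> = ev y" using ego_signature_hom_poper[OF hom h x(1) y(2)] \<beta> x(2) by simp
      then show ?thesis using \<psi>[OF x(1)] \<psi>[OF y(1)] y(2) x(2) by simp
    qed
    show "[\<psi> \<alpha>, \<psi> \<beta>] \<in> rels X (Approx m)"
      if m: "1 \<le> m" "m \<le> n - 1" and \<alpha>: "\<alpha> \<in> points ?D" and \<beta>: "\<beta> \<in> points ?D"
        and r: "[\<alpha>, \<beta>] \<in> rels ?D (Approx m)" for m \<alpha> \<beta>
    proof -
      obtain x where x: "x \<in> points X" "\<alpha> = ev x" using \<alpha> surj by blast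
      obtain y where y: "y \<in> points X" "\<beta> = ev y" using \<beta> surj by blast
      have app: "\<forall>u\<in>?B. approx m (u x) (u y)" using r x y by (simp add: rels_D)
      have "[x, y] \<in> rels X (Approx m)"
        by (rule determines_approx[OF X(3) m x(1) y(1)]) (use app in blast)
      then show ?thesis using \<psi>[OF x(1)] \<psi>[OF y(1)] x(2) y(2) by simp
    qed
  qed
  moreover have "ev (\<psi> \<alpha>) = \<alpha>" if "\<alpha> \<in> points ?D" for \<alpha>
  proof -
    obtain x where "x \<in> points X" "\<alpha> = ev x" using \<open>\<alpha> \<in> points ?D\<close> surj by blast
    then show ?thesis using \<psi>[of x] by simp
  qed
  ultimately show ?thesis using hom \<psi> unfolding ev_def[symmetric] str_iso_def by blast
qed

theorem theorem6p4:
  fixes n :: nat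
  assumes "1 \<le> n"
  shows "alter_ego sugihara_signature (ego_partial_signature n) (ego_relation_signature n)
           (Z_even n) (Z_even_ego n) \<and>
         yields_strong_duality TYPE('i) TYPE('a) TYPE('x) TYPE('y)
           sugihara_signature (ego_partial_signature n) (ego_relation_signature n)
           (Z_even n) (Z_even_ego n)"
  unfolding yields_strong_duality_def yields_full_duality_def
  using alter_ego_Z_even[OF assms] ego_duality ego_full_duality ego_injective by blast

end
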